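(* Assume the fixed-design regression model and the neural network sieve $\mathcal F_{r_n}$ described in the context, with $r_n,V_n,M_n\uparrow\infty$, and let $\hat f_n\in\mathcal F_{r_n}$ be an approximate sieve estimator, i.e. $\mathbb Q_n(\hat f_n)\le\inf_{f\in\mathcal F_{r_n}}\mathbb Q_n(f)+\mathcal O_p(\eta_n)$ with $\eta_n\to0$. If $$[r_n(d+2)+1]\,V_n^2\,\log\big(V_n[r_n(d+2)+1]\big)=o(n)\quad\text{as }n\to\infty,$$ then $\|\hat f_n-f_0\|_n\to0$ in probability.
   Context: Model: $y_i=f_0(\mathbf x_i)+\epsilon_i$, $i=1,\dots,n$, where $\epsilon_1,\epsilon_2,\dots$ are i.i.d. random variables on a complete probability space $(\Omega,\mathcal A,\mathbb P)$ with $\mathbb E[\epsilon]=0$ and $\mathrm{Var}[\epsilon]=\sigma^2<\infty$; the $\mathbf x_i\in\mathcal X\subset\mathbb R^d$ are deterministic (fixed design), $\mathcal X$ is compact, $d$ is fixed, and $f_0\in\mathcal F$ is unknown, where $\mathcal F$ is the class of continuous real functions on the compact set $\mathcal X$. Empirical criterion: $\mathbb Q_n(f)=\frac1n\sum_{i=1}^n(y_i-f(\mathbf x_i))^2$. Pseudo-norm: $\|f\|_n^2=\frac1n\sum_{i=1}^nf^2(\mathbf x_i)$. Sieve: let $\sigma(z)=1/(1+e^{-z})$ (the function $\sigma(\cdot)$ is unrelated to the variance $\sigma^2$). For positive integers $r_n$ and reals $V_n>4$, $M_n>0$, $\mathcal F_{r_n}$ is the set of functions $\mathbf x\mapsto\alpha_0+\sum_{j=1}^{r_n}\alpha_j\sigma(\boldsymbol\gamma_j^T\mathbf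 x+\gamma_{0,j})$ with $\boldsymbol\gamma_j=(\gamma_{1,j},\dots,\gamma_{d,j})^T\in\mathbb R^d$, $\alpha_j,\gamma_{0,j}\in\mathbb R$, $\sum_{j=0}^{r_n}|\alpha_j|\le V_n$ and $\max_{1\le j\le r_n}\sum_{i=0}^d|\gamma_{i,j}|\le M_n$. *)

theory Defs
  imports "HOL-Probability.Probability" "HOL-Library.Landau_Symbols"
begin

definition sigmoid :: "real \<Rightarrow> real" where
  "sigmoid z = 1 / (1 + exp (- z))"

(* Networks are total functions on R^d.  They are only ever evaluated at points of the
   compact domain, so this is the sieve of restrictions to that domain with a choice
   of representative.  Meant for r \<ge> 1. *)
definition nn_sieve :: "nat \<Rightarrow> real \<Rightarrow> real \<Rightarrow> (real ^ 'd \<Rightarrow> real) set" where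
  "nn_sieve r V M = {f. \<exists>(\<alpha> :: nat \<Rightarrow> real) (\<gamma> :: nat \<Rightarrow> real ^ 'd) (\<gamma>0 :: nat \<Rightarrow> real).
      f = (\<lambda>u. \<alpha> 0 + (\<Sum>j=1..r. \<alpha> j * sigmoid (\<gamma> j \<bullet> u + \<gamma>0 j))) \<and>
      (\<Sum>j=0..r. \<bar>\<alpha> j\<bar>) \<le> V \<and>
      (MAX j\<in>{1..r}. \<bar>\<gamma>0 j\<bar> + (\<Sum>i\<in>UNIV. \<bar>\<gamma> j $ i\<bar>)) \<le> M}"

definition emp_risk :: "(nat \<Rightarrow> 'a) \<Rightarrow> nat \<Rightarrow> (nat \<Rightarrow> real) \<Rightarrow> ('a \<Rightarrow> real) \<Rightarrow> real" where
  "emp_risk x n y f = 1 / real n * (\<Sum>i=1..n. (y i - f (x i))\<^sup>2)"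

definition emp_norm :: "(nat \<Rightarrow> 'a) \<Rightarrow> nat \<Rightarrow> ('a \<Rightarrow> real) \<Rightarrow> real" where
  "emp_norm x n f = sqrt (1 / real n * (\<Sum>i=1..n. (f (x i))\<^sup>2))"

(* R n = O_p(\<eta> n).  Where \<eta> n = 0, the condition bounds the probability that R n \<noteq> 0. *)
definition bigO_in_prob :: "'w measure \<Rightarrow> (nat \<Rightarrow> 'w \<Rightarrow> real) \<Rightarrow> (nat \<Rightarrow> real) \<Rightarrow> bool" where
  "bigO_in_prob M R \<eta> \<longleftrightarrow> (\<forall>n. R n \<in> borel_measurable M) \<and>
     (\<forall>e>0. \<exists>C>0. \<forall>\<^sub>F n in sequentially.
        measure M {\<omega> \<in> space M. \<bar>R n \<omega>\<bar> > C * \<bar>\<eta> n\<bar>} < e)"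

definition tendsto_in_prob :: "'w measure \<Rightarrow> (nat \<Rightarrow> 'w \<Rightarrow> real) \<Rightarrow> real \<Rightarrow> bool" where
  "tendsto_in_prob M Z c \<longleftrightarrow> (\<forall>n. Z n \<in> borel_measurable M) \<and>
     (\<forall>e>0. (\<lambda>n. measure M {\<omega> \<in> space M. \<bar>Z n \<omega> - c\<bar> > e}) \<longlonglongrightarrow> 0)"

(* Sample sizes and observations are numbered from 1.  Measurability of fhat n as a map into
   the sieve with the sup-norm over the compact set X is expressed pointwise: the continuous
   functions on X are separable, so their Borel sigma-algebra is generated by the
   evaluations at points of X. *)
definition approx_sieve_estimator ::
  "'w measure \<Rightarrow> (real ^ 'd) set \<Rightarrow> (nat \<Rightarrow> real ^ 'd) \<Rightarrow> (nat \<Rightarrow> 'w \<Rightarrow> real) \<Rightarrow>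
   (nat \<Rightarrow> (real ^ 'd \<Rightarrow> real) set) \<Rightarrow> (nat \<Rightarrow> real) \<Rightarrow>
   (nat \<Rightarrow> 'w \<Rightarrow> real ^ 'd \<Rightarrow> real) \<Rightarrow> bool" where
  "approx_sieve_estimator M X x y S \<eta> fhat \<longleftrightarrow>
     (\<forall>n\<ge>1. \<forall>\<omega>\<in>space M. fhat n \<omega> \<in> S n) \<and>
     (\<forall>n\<ge>1. \<forall>u\<in>X. (\<lambda>\<omega>. fhat n \<omega> u) \<in> borel_measurable M) \<and>
     (\<exists>R. bigO_in_prob M R \<eta> \<and>
        (\<forall>n\<ge>1. AE \<omega> in M.
           emp_risk x n (\<lambda>i. y i \<omega>) (fhat n \<omega>)
             \<le> (INF f\<in>S n. emp_risk x n (\<lambda>i. y i \<omega>) f) + R n \<omega>))"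

end

theory Submission
  imports Defs "HOL-Real_Asymp.Real_Asymp"
begin

text \<open>
  Comparing \<open>fhat\<close> with a fixed sieve element close to \<open>f0\<close> reduces the claim to the vanishing in
  probability of the supremum of \<open>1/n * (\<Sum>i\<le>n. eps i * f (x i))\<close> over the sieve. A network is an
  \<open>\<ell>\<^sup>1\<close>-combination of weight at most \<open>V n\<close> of a constant and of neurons, and, the sigmoid being
  increasing, a neuron restricted to the design is a mixture of half-space indicators. So the
  supremum is at most \<open>V n\<close> times a maximum over the polynomially many half-space traces on the
  \<open>n\<close> design points; after truncating the noise at level \<open>V n\<close>,
  Chernoff's inequality and a union bound finish, provided that \<open>(V n)\<^sup>2 * ln n = o(n)\<close>. The density
  of the sieves holds because \<open>exp c * sigmoid (t - c)\<close> tends to \<open>exp t\<close> as \<open>c \<rightarrow> \<infinity>\<close>, and the sums of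
  exponentials of linear forms are an algebra, to which Stone--Weierstrass applies.
\<close>

subsection \<open>Half-space traces and the noise process over the sieve\<close>

lemma card_halfspace_traces_le:
  fixes z :: "'i \<Rightarrow> 'a :: euclidean_space"
  assumes "finite I" and "subspace L"
  shows "card ((\<lambda>l. {i\<in>I. l \<bullet> z i > 0}) ` L) \<le> (card I + 1) ^ dim L"
  using assms
proof (induction I arbitrary: L rule: finite_induct)
  case empty
  have "card ((\<lambda>l. {i\<in>{}. l \<bullet> z i > 0}) ` L) \<le> card {{} :: 'i set}"
    by (intro card_mono) auto
  then show ?case by simp
next
  case (insert k I)
  define T where "T = (\<lambda>J K. (\<lambda>l. {i\<in>J. l \<bullet> z i > 0}) ` K)"
  \<comment> \<open>The traces are split by whether they contain \<open>k\<close>. With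
    \<open>k\<close> removed from the members of \<open>W\<close>, the set
    \<open>U \<union> W'\<close> consists of traces on \<open>I\<close>, and
    \<open>U \<inter> W'\<close> of those that extend in both ways to \<open>k\<close> and so are
    counted twice.\<close>
  define U where "U = {B \<in> T (insert k I) L. k \<notin> B}"
  define W where "W = {B \<in> T (insert k I) L. k \<in> B}"
  define W' where "W' = (\<lambda>B. B - {k}) ` W"
  define L' where "L' = L \<inter> {l. z k \<bullet> l = 0}"
  have T_Pow: "T J K \<subseteq> Pow J" for J K
    by (auto simp: T_def)
  have fin: "finite (T J K)" if "finite J" for J K
    using finite_subset[OF T_Pow] that by blast
  have finU: "finite U" and finW: "finite W"
    using fin[of "insert k I"] insert.hyps by (auto simp: U_def W_def)
  have "inj_on (\<lambda>B. B - {k}) W"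
    by (rule inj_onI) (auto simp: W_def)
  then have cardW': "card W' = card W"
    by (simp add: W'_def card_image)
  have "T (insert k I) L = U \<union> W" "U \<inter> W = {}"
    by (auto simp: U_def W_def)
  then have "card (T (insert k I) L) = card U + card W"
    using finU finW by (simp add: card_Un_disjoint)
  also have "\<dots> = card (U \<union> W') + card (U \<inter> W')"
    using card_Un_Int[of U W'] finU finW cardW' by (simp add: W'_def)
  finally have split: "card (T (insert k I) L) = card (U \<union> W') + card (U \<inter> W')" .
  have trace: "{i \<in> insert k I. l \<bullet> z i > 0} - {k} = {i \<in> I. l \<bullet> z i > 0}" for l
    using insert.hyps by auto
  have "U \<subseteq> T I L"
  proof
    fix B assume "B \<in> U"
    then obtain l where "l \<in> L" "B = {i \<in> insert k I. l \<bullet> z i > 0}" "k \<notin> B"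
      by (auto simp: U_def T_def)
    then have "B = {i \<in> I. l \<bullet> z i > 0}" using trace[of l] by auto
    with \<open>l \<in> L\<close> show "B \<in> T I L" by (auto simp: T_def)
  qed
  moreover have "W' \<subseteq> T I L"
  proof
    fix B assume "B \<in> W'"
    then obtain l where "l \<in> L" "B = {i \<in> insert k I. l \<bullet> z i > 0} - {k}"
      by (auto simp: W'_def W_def T_def)
    then show "B \<in> T I L" using trace[of l] by (auto simp: T_def)
  qed
  ultimately have "card (U \<union> W') \<le> card (T I L)"
    using fin[of I L] insert.hyps by (intro card_mono) auto
  also have "\<dots> \<le> (card I + 1) ^ dim L"
    unfolding T_def by (rule insert.IH[OF insert.prems])
  finally have 1: "card (U \<union> W') \<le> (card I + 1) ^ dim L" .
  show ?case
  proof (cases "\<forall>l\<in>L. z k \<bullet> l = 0")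
    case True
    then have "W = {}"
      by (auto simp: W_def T_def inner_commute)
    then have "W' = {}" by (simp add: W'_def)
    then have "card (T (insert k I) L) \<le> (card I + 1) ^ dim L"
      using split 1 by simp
    also have "\<dots> \<le> (card (insert k I) + 1) ^ dim L"
      using insert.hyps by (intro power_mono) auto
    finally show ?thesis by (simp add: T_def)
  next
    case False
    have L': "subspace L'"
      unfolding L'_def by (intro subspace_inter insert.prems subspace_hyperplane)
    have "L' \<subset> L" using False by (auto simp: L'_def)
    then have "span L' \<subset> span L"
      using L' insert.prems by (metis span_eq_iff)
    then have less: "dim L' < dim L" by (rule dim_psubset)
    \<comment> \<open>If the trace on \<open>I\<close> extends in both ways to \<open>k\<close>, a convex combination of two witnesses
        has the same trace and vanishes at \<open>z k\<close>.\<close>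
    have "U \<inter> W' \<subseteq> T I L'"
    proof
      fix B assume "B \<in> U \<inter> W'"
      then obtain l m where l: "l \<in> L" "B = {i \<in> insert k I. l \<bullet> z i > 0}" "k \<notin> B"
        and m: "m \<in> L" "B = {i \<in> insert k I. m \<bullet> z i > 0} - {k}" "m \<bullet> z k > 0"
        by (auto simp: U_def W'_def W_def T_def)
      \<comment> \<open>The weights make \<open>h\<close> vanish at \<open>z k\<close>. Only
        \<open>a\<close> is strictly positive, since \<open>l \<bullet> z k\<close> may be 0; this
        suffices, because \<open>l\<close> and \<open>m\<close> have the same trace on
        \<open>I\<close> and the positive multiple of \<open>l\<close> decides the sign.\<close>
      define a where "a = m \<bullet> z k"
      define b where "b = - (l \<bullet> z k)"
      define h where "h = a *\<^sub>R l + b *\<^sub>R m"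
      have a: "a > 0" using m by (simp add: a_def)
      have b: "b \<ge> 0" using l by (auto simp: b_def)
      have "h \<in> L" unfolding h_def
        using insert.prems l m by (intro subspace_add subspace_scale)
      moreover have "z k \<bullet> h = 0"
        by (simp add: h_def inner_add_right inner_diff_right a_def b_def inner_commute)
      ultimately have "h \<in> L'" by (simp add: L'_def)
      moreover have "B = {i \<in> I. h \<bullet> z i > 0}"
      proof -
        have Bl: "B = {i \<in> I. l \<bullet> z i > 0}" using l trace[of l] by auto
        have Bm: "B = {i \<in> I. m \<bullet> z i > 0}" using m trace[of m] by auto
        have "h \<bullet> z i > 0 \<longleftrightarrow> l \<bullet> z i > 0" if "i \<in> I" for i
        proof (cases "l \<bullet> z i > 0")
          case True
          then have "m \<bullet> z i > 0" using Bl Bm that by blast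
          then show ?thesis using True a b
            by (simp add: h_def inner_add_left add_pos_nonneg)
        next
          case f: False
          then have "\<not> m \<bullet> z i > 0" using Bl Bm that by blast
          then have "a * (l \<bullet> z i) \<le> 0" "b * (m \<bullet> z i) \<le> 0"
            using f a b by (auto simp: mult_le_0_iff)
          then show ?thesis using f
            by (simp add: h_def inner_add_left)
        qed
        then show ?thesis using Bl by auto
      qed
      ultimately show "B \<in> T I L'" by (auto simp: T_def)
    qed
    then have "card (U \<inter> W') \<le> card (T I L')"
      using fin[of I L'] insert.hyps by (intro card_mono) auto
    also have "\<dots> \<le> (card I + 1) ^ dim L'"
      unfolding T_def by (rule insert.IH[OF L'])
    also have "\<dots> \<le> (card I + 1) ^ (dim L - 1)"
      using less by (intro power_increasing) auto
    finally have 2: "card (U \<inter> W') \<le> (card I + 1) ^ (dim L - 1)" .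
    obtain D where D: "dim L = Suc D" using less by (cases "dim L") auto
    have "card (T (insert k I) L) \<le> (card I + 1) ^ Suc D + (card I + 1) ^ D"
      using split 1 2 D by simp
    also have "\<dots> = (card I + 2) * (card I + 1) ^ D" by (simp add: algebra_simps)
    also have "\<dots> \<le> (card I + 2) * (card I + 2) ^ D"
      by (intro mult_left_mono power_mono) auto
    also have "\<dots> = (card (insert k I) + 1) ^ dim L"
      using insert.hyps D by simp
    finally show ?thesis by (simp add: T_def)
  qed
qed

text \<open>Layer-cake formula: \<open>p i\<close> is the integral over \<open>s\<close> in the unit
  interval of the indicator of \<open>p i > s\<close>. The weighted sum is therefore an average over
  \<open>s\<close> of plain sums over superlevel sets, each of them bounded by
  \<open>B\<close>.\<close>

lemma abs_sum_mult_le_superlevel: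
  fixes p e :: "'i \<Rightarrow> real"
  assumes I: "finite I" and p: "\<And>i. i \<in> I \<Longrightarrow> 0 \<le> p i \<and> p i \<le> 1"
    and B: "\<And>s. \<bar>\<Sum>i\<in>{i\<in>I. p i > s}. e i\<bar> \<le> B"
  shows "\<bar>\<Sum>i\<in>I. e i * p i\<bar> \<le> B"
proof -
  \<comment> \<open>The interval is open on the right so that, for \<open>s \<ge> 0\<close>, the
    indicator expresses the strict inequality \<open>p i > s\<close>.\<close>
  define g where "g = (\<lambda>s. \<Sum>i\<in>I. e i * indicator {0..<p i} s)"
  have int: "integrable lborel (\<lambda>s. e i * indicator {0..<p i} s)" if "i \<in> I" for i
    using p[OF that] by (intro integrable_mult_right integrable_real_indicator) auto
  have "(\<integral>s. g s \<partial>lborel) = (\<Sum>i\<in>I. \<integral>s. e i * indicator {0..<p i} s \<partial>lborel)"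
    unfolding g_def using int by (intro Bochner_Integration.integral_sum) auto
  also have "\<dots> = (\<Sum>i\<in>I. e i * p i)"
    using p by (intro sum.cong) auto
  finally have g: "(\<integral>s. g s \<partial>lborel) = (\<Sum>i\<in>I. e i * p i)" .
  have bound: "\<bar>g s\<bar> \<le> B * indicator {0..1} s" for s
  proof (cases "s \<in> {0..1}")
    case True
    have "g s = (\<Sum>i\<in>I. if p i > s then e i else 0)"
      unfolding g_def using True by (intro sum.cong) (auto simp: indicator_def)
    also have "\<dots> = (\<Sum>i\<in>{i\<in>I. p i > s}. e i)"
      using I by (simp add: sum.inter_filter)
    finally show ?thesis using B[of s] True by simp
  next
    case False
    then have "g s = 0"
      unfolding g_def using p by (intro sum.neutral) (force simp: indicator_def)
    then show ?thesis using False by simp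
  qed
  have intg: "integrable lborel g"
    unfolding g_def using int by (intro Bochner_Integration.integrable_sum) auto
  have "\<bar>\<integral>s. g s \<partial>lborel\<bar> \<le> (\<integral>s. \<bar>g s\<bar> \<partial>lborel)"
    by (rule integral_abs_bound)
  also have "\<dots> \<le> (\<integral>s. B * indicator {0..1::real} s \<partial>lborel)"
    using bound intg by (intro integral_mono integrable_abs) auto
  also have "\<dots> = B" by simp
  finally show ?thesis using g by simp
qed

lemma sigmoid_pos: "0 < sigmoid t"
  by (simp add: sigmoid_def add_pos_pos)

lemma sigmoid_le_1: "sigmoid t \<le> 1"
  by (simp add: sigmoid_def divide_le_eq_1 add_pos_pos)

text \<open>The logit inverts the sigmoid, so at levels strictly between 0 and 1 the superlevel set
  of a neuron is an open half-space.\<close>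

lemma sigmoid_superlevel:
  assumes "0 < s" "s < 1"
  shows "sigmoid t > s \<longleftrightarrow> t > ln (s / (1 - s))"
proof -
  have "sigmoid t > s \<longleftrightarrow> exp (- t) < (1 - s) / s"
    using assms by (simp add: sigmoid_def field_simps add_pos_pos)
  also have "\<dots> \<longleftrightarrow> - t < ln ((1 - s) / s)"
    using assms by (subst ln_less_cancel_iff[symmetric]) auto
  also have "\<dots> \<longleftrightarrow> t > ln (s / (1 - s))"
    using assms by (auto simp: ln_div)
  finally show ?thesis .
qed

text \<open>The extra coordinate 1 turns affine half-spaces into linear ones, to which the count
  over a subspace applies with the dimension raised by one.\<close>

definition halfspace_traces :: "(nat \<Rightarrow> 'a :: euclidean_space) \<Rightarrow> nat \<Rightarrow> nat set set" where
  "halfspace_traces x n = range (\<lambda>l :: 'a \<times> real. {i\<in>{1..n}. l \<bullet> (x i, 1) > 0})"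

lemma halfspace_traces_subset: "halfspace_traces x n \<subseteq> Pow {1..n}"
  by (auto simp: halfspace_traces_def)

lemma card_halfspace_traces:
  fixes x :: "nat \<Rightarrow> 'a :: euclidean_space"
  shows "card (halfspace_traces x n) \<le> (n + 1) ^ (DIM('a) + 1)"
  using card_halfspace_traces_le[of "{1..n}" "UNIV :: ('a \<times> real) set" "\<lambda>i. (x i, 1)"]
  by (simp add: halfspace_traces_def)

lemma halfspace_trace_mem: "{i\<in>{1..n}. g \<bullet> x i + c > s} \<in> halfspace_traces x n"
proof -
  have "{i\<in>{1..n}. g \<bullet> x i + c > s} = {i\<in>{1..n}. (g, c - s) \<bullet> (x i, 1) > 0}"
    by (auto simp: algebra_simps)
  then show ?thesis unfolding halfspace_traces_def by (rule range_eqI)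
qed

text \<open>Every superlevel set of a neuron on the design is a half-space trace, so the layer-cake
  bound reduces the infinite family of neurons to finitely many index sets.\<close>

lemma abs_sum_neuron_le:
  fixes x :: "nat \<Rightarrow> 'a :: euclidean_space"
  assumes B: "\<And>A. A \<in> halfspace_traces x n \<Longrightarrow> \<bar>\<Sum>i\<in>A. e i\<bar> \<le> B"
  shows "\<bar>\<Sum>i=1..n. e i * sigmoid (g \<bullet> x i + c)\<bar> \<le> B"
proof (rule abs_sum_mult_le_superlevel)
  fix s :: real
  have mem: "{i\<in>{1..n}. sigmoid (g \<bullet> x i + c) > s} \<in> halfspace_traces x n"
  proof -
    \<comment> \<open>Levels outside the open unit interval give the full and the empty index set,
      which are the traces of the constant affine functions 1 and 0.\<close>
    consider "s \<le> 0" | "0 < s" "s < 1" | "s \<ge> 1" by linarith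
    then show ?thesis
    proof cases
      case 1
      have "{i\<in>{1..n}. sigmoid (g \<bullet> x i + c) > s} = {i\<in>{1..n}. 0 \<bullet> x i + 1 > (0::real)}"
        using 1 sigmoid_pos by (auto intro: le_less_trans)
      then show ?thesis using halfspace_trace_mem by metis
    next
      case 2
      then show ?thesis unfolding sigmoid_superlevel[OF 2] by (intro halfspace_trace_mem)
    next
      case 3
      have "{i\<in>{1..n}. sigmoid (g \<bullet> x i + c) > s} = {i\<in>{1..n}. 0 \<bullet> x i + 0 > (0::real)}"
        using 3 sigmoid_le_1 by (auto simp: not_less intro: order_trans)
      then show ?thesis using halfspace_trace_mem by metis
    qed
  qed
  show "\<bar>\<Sum>i\<in>{i\<in>{1..n}. sigmoid (g \<bullet> x i + c) > s}. e i\<bar> \<le> B"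
    by (rule B[OF mem])
qed (auto simp: sigmoid_pos sigmoid_le_1 less_imp_le)

lemma abs_sum_nn_sieve_le:
  fixes x :: "nat \<Rightarrow> real ^ 'd"
  assumes f: "f \<in> nn_sieve r V W"
    and B: "\<And>A. A \<in> halfspace_traces x n \<Longrightarrow> \<bar>\<Sum>i\<in>A. e i\<bar> \<le> B"
  shows "\<bar>\<Sum>i=1..n. e i * f (x i)\<bar> \<le> V * B"
proof -
  obtain a :: "nat \<Rightarrow> real" and g :: "nat \<Rightarrow> real ^ 'd" and c :: "nat \<Rightarrow> real"
    where fdef: "f = (\<lambda>u. a 0 + (\<Sum>j=1..r. a j * sigmoid (g j \<bullet> u + c j)))"
      and V: "(\<Sum>j=0..r. \<bar>a j\<bar>) \<le> V"
    using f by (auto simp: nn_sieve_def)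
  define S where "S j = (\<Sum>i=1..n. e i * sigmoid (g j \<bullet> x i + c j))" for j
  \<comment> \<open>The full index set is a trace as well; it takes care of the constant term
    \<open>a 0\<close> of the network.\<close>
  have "{i\<in>{1..n}. 0 \<bullet> x i + 1 > (0::real)} \<in> halfspace_traces x n"
    by (rule halfspace_trace_mem)
  moreover have "{i\<in>{1..n}. 0 \<bullet> x i + 1 > (0::real)} = {1..n}" by auto
  ultimately have "{1..n} \<in> halfspace_traces x n" by simp
  then have B0: "\<bar>\<Sum>i=1..n. e i\<bar> \<le> B" by (rule B)
  have BS: "\<bar>S j\<bar> \<le> B" for j
    unfolding S_def by (intro abs_sum_neuron_le B)
  have "(\<Sum>i=1..n. e i * f (x i))
      = (\<Sum>i=1..n. a 0 * e i + (\<Sum>j=1..r. a j * (e i * sigmoid (g j \<bullet> x i + c j))))"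
    by (simp add: fdef algebra_simps sum_distrib_left)
  also have "\<dots> = a 0 * (\<Sum>i=1..n. e i) + (\<Sum>j=1..r. a j * S j)"
    by (simp add: sum.distrib sum_distrib_left S_def) (rule sum.swap)
  finally have "\<bar>\<Sum>i=1..n. e i * f (x i)\<bar> \<le> \<bar>a 0 * (\<Sum>i=1..n. e i)\<bar> + \<bar>\<Sum>j=1..r. a j * S j\<bar>"
    by linarith
  also have "\<bar>\<Sum>j=1..r. a j * S j\<bar> \<le> (\<Sum>j=1..r. \<bar>a j * S j\<bar>)"
    by (rule sum_abs)
  also have "\<dots> \<le> (\<Sum>j=1..r. \<bar>a j\<bar> * B)"
    using BS by (intro sum_mono) (simp add: abs_mult mult_left_mono)
  also have "\<bar>a 0 * (\<Sum>i=1..n. e i)\<bar> \<le> \<bar>a 0\<bar> * B"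
    using B0 by (simp add: abs_mult mult_left_mono)
  also have "\<bar>a 0\<bar> * B + (\<Sum>j=1..r. \<bar>a j\<bar> * B) = (\<Sum>j=0..r. \<bar>a j\<bar>) * B"
    by (simp add: sum.atLeast_Suc_atMost sum_distrib_right distrib_right)
  also have "\<dots> \<le> V * B"
    using V B0 by (intro mult_right_mono) auto
  finally show ?thesis by simp
qed

subsection \<open>Density of the sieves in the continuous functions\<close>

text \<open>With lists of coefficients and directions, addition of functions is concatenation, and a
  product is the list of pairwise products with added directions; repeated directions are
  allowed.\<close>

definition exp_sum :: "(real \<times> 'a :: euclidean_space) list \<Rightarrow> 'a \<Rightarrow> real" where
  "exp_sum ps u = (\<Sum>(b, g)\<leftarrow>ps. b * exp (g \<bullet> u))"

lemma exp_sum_simps [simp]: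
  "exp_sum [] u = 0"
  "exp_sum ((b, g) # ps) u = b * exp (g \<bullet> u) + exp_sum ps u"
  by (simp_all add: exp_sum_def)

lemma exp_sum_append [simp]: "exp_sum (ps @ qs) u = exp_sum ps u + exp_sum qs u"
  by (simp add: exp_sum_def)

lemma exp_sum_shift:
  "exp_sum (map (\<lambda>(b', g'). (b * b', g + g')) ps) u = b * exp (g \<bullet> u) * exp_sum ps u"
  by (induction ps) (auto simp: algebra_simps exp_add)

lemma exp_sum_mult: "\<exists>rs. \<forall>u. exp_sum rs u = exp_sum ps u * exp_sum qs u"
proof (induction ps)
  case Nil
  have "\<forall>u. exp_sum [] u = exp_sum [] u * exp_sum qs u" by simp
  then show ?case by blast
next
  case (Cons p ps)
  obtain b g where p: "p = (b, g)" by (cases p)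
  from Cons obtain rs where rs: "\<forall>u. exp_sum rs u = exp_sum ps u * exp_sum qs u" by blast
  have "\<forall>u. exp_sum (map (\<lambda>(b', g'). (b * b', g + g')) qs @ rs) u
      = exp_sum (p # ps) u * exp_sum qs u"
    using rs by (simp add: p exp_sum_shift distrib_right)
  then show ?case by blast
qed

lemma continuous_on_exp_sum: "continuous_on S (exp_sum ps)"
proof (induction ps)
  case Nil
  then show ?case by (simp add: exp_sum_def)
next
  case (Cons p ps)
  obtain b g where p: "p = (b, g)" by (cases p)
  have "exp_sum (p # ps) = (\<lambda>u. b * exp (g \<bullet> u) + exp_sum ps u)"
    by (simp add: p fun_eq_iff)
  then show ?case using Cons by (auto intro!: continuous_intros)
qed

lemma exp_sum_dense:
  fixes X :: "'a :: euclidean_space set"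
  assumes X: "compact X" and f: "continuous_on X f" and e: "0 < e"
  obtains ps where "\<And>u. u \<in> X \<Longrightarrow> \<bar>f u - exp_sum ps u\<bar> < e"
proof -
  interpret function_ring_on "range (exp_sum :: (real \<times> 'a) list \<Rightarrow> _)" X
  proof
    show "compact X" by (rule X)
    show "continuous_on X g" if "g \<in> range exp_sum" for g :: "'a \<Rightarrow> real"
      using that continuous_on_exp_sum by auto
    show "(\<lambda>u. g u + h u) \<in> range exp_sum" if gh: "g \<in> range exp_sum" "h \<in> range exp_sum"
      for g h :: "'a \<Rightarrow> real"
    proof -
      obtain ps qs where "g = exp_sum ps" "h = exp_sum qs" using gh by auto
      then have "(\<lambda>u. g u + h u) = exp_sum (ps @ qs)" by auto
      then show ?thesis by (rule range_eqI)
    qed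
    show "(\<lambda>u. g u * h u) \<in> range exp_sum" if gh: "g \<in> range exp_sum" "h \<in> range exp_sum"
      for g h :: "'a \<Rightarrow> real"
    proof -
      obtain ps qs where "g = exp_sum ps" "h = exp_sum qs" using gh by auto
      moreover obtain rs where "\<forall>u. exp_sum rs u = exp_sum ps u * exp_sum qs u"
        using exp_sum_mult by blast
      ultimately have "(\<lambda>u. g u * h u) = exp_sum rs" by auto
      then show ?thesis by (rule range_eqI)
    qed
    show "(\<lambda>_. c) \<in> range (exp_sum :: (real \<times> 'a) list \<Rightarrow> _)" for c
    proof (rule range_eqI)
      show "(\<lambda>_. c) = exp_sum [(c, 0 :: 'a)]" by auto
    qed
    show "\<exists>g\<in>range exp_sum. g u \<noteq> g v" if "u \<noteq> v" for u v :: 'a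
    proof
      \<comment> \<open>The exponential in the direction \<open>u - v\<close> separates the points:
        the two inner products differ by \<open>(u - v) \<bullet> (u - v)\<close>, which is
        positive.\<close>
      have "(u - v) \<bullet> u \<noteq> (u - v) \<bullet> v"
        using that by (metis inner_diff_right inner_eq_zero_iff right_minus_eq)
      then show "exp_sum [(1, u - v)] u \<noteq> exp_sum [(1, u - v)] v" by simp
    qed (rule rangeI)
  qed
  show ?thesis using Stone_Weierstrass_basic[OF f e] that by blast
qed

text \<open>Far to the left the sigmoid behaves like the exponential:
  \<open>exp c * sigmoid (t - c)\<close> equals \<open>exp t / (1 + exp (t - c))\<close>. The error
  bound is uniform over \<open>t\<close> bounded above.\<close>

lemma sigmoid_exp_approx: "\<bar>exp c * sigmoid (t - c) - exp t\<bar> \<le> exp (2 * t - c)"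
proof -
  have pos: "1 + exp (t - c) > 0" by (simp add: add_pos_pos)
  have "exp c * sigmoid (t - c) = exp t / (1 + exp (t - c))"
  proof -
    have "1 + exp (t - c) = exp (t - c) * (1 + exp (- (t - c)))"
      by (simp add: algebra_simps flip: exp_add)
    then have "exp t / (1 + exp (t - c)) = exp t / exp (t - c) * sigmoid (t - c)"
      by (simp add: sigmoid_def)
    also have "exp t / exp (t - c) = exp c" by (simp flip: exp_diff)
    finally show ?thesis by simp
  qed
  then have "exp t - exp c * sigmoid (t - c) = exp t * exp (t - c) / (1 + exp (t - c))"
    using pos by (simp add: field_simps)
  also have "exp t * exp (t - c) = exp (2 * t - c)"
    by (simp flip: exp_add add: algebra_simps)
  finally have eq: "exp t - exp c * sigmoid (t - c) = exp (2 * t - c) / (1 + exp (t - c))" .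
  have "exp (2 * t - c) / (1 + exp (t - c)) \<le> exp (2 * t - c) / 1"
    by (intro divide_left_mono) (auto intro: add_pos_pos)
  moreover have "0 \<le> exp (2 * t - c) / (1 + exp (t - c))" using pos by simp
  ultimately show ?thesis using eq by linarith
qed

text \<open>Each exponential becomes one neuron with bias \<open>- c\<close> and outer weight
  \<open>b j * exp c\<close>. Since \<open>X\<close> is bounded, one shift \<open>c\<close> serves
  all terms and all points. A larger sieve is reached by padding with zero neurons.\<close>

lemma exp_sum_approx_nn_sieve:
  fixes ps :: "(real \<times> (real ^ 'd)) list"
  assumes X: "bounded X" and e: "0 < e"
  obtains r0 V0 W0 where
    "\<And>r V W. r \<ge> r0 \<Longrightarrow> V \<ge> V0 \<Longrightarrow> W \<ge> W0 \<Longrightarrow>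
       \<exists>g\<in>nn_sieve r V W. \<forall>u\<in>X. \<bar>g u - exp_sum ps u\<bar> < e"
proof -
  define m where "m = length ps"
  \<comment> \<open>List positions start at 0, neurons at 1. The default 0 removes both the constant
    term \<open>j = 0\<close> and the padded neurons beyond \<open>m\<close>.\<close>
  define b where "b j = (if j \<in> {1..m} then fst (ps ! (j - 1)) else 0)" for j
  define g where "g j = (if j \<in> {1..m} then snd (ps ! (j - 1)) else 0)" for j
  have es: "exp_sum ps u = (\<Sum>j=1..m. b j * exp (g j \<bullet> u))" for u
  proof -
    have "exp_sum ps u = (\<Sum>k=0..<m. fst (ps ! k) * exp (snd (ps ! k) \<bullet> u))"
      unfolding exp_sum_def by (simp add: sum_list_sum_nth m_def case_prod_unfold)
    also have "\<dots> = (\<Sum>j=1..m. b j * exp (g j \<bullet> u))"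
      by (rule sum.reindex_bij_witness[of _ "\<lambda>j. j - 1" Suc]) (auto simp: b_def g_def)
    finally show ?thesis .
  qed
  obtain K0 where K0: "\<And>u. u \<in> X \<Longrightarrow> norm u \<le> K0" using X by (auto simp: bounded_iff)
  \<comment> \<open>A common upper bound for all exponents on \<open>X\<close>. The absolute value
    covers an empty \<open>X\<close>, for which \<open>K0\<close> may be negative.\<close>
  define K where "K = (\<Sum>j=1..m. norm (g j)) * \<bar>K0\<bar>"
  have K: "g j \<bullet> u \<le> K" if "j \<in> {1..m}" "u \<in> X" for j u
  proof -
    have "g j \<bullet> u \<le> norm (g j) * norm u" by (rule norm_cauchy_schwarz)
    also have "\<dots> \<le> (\<Sum>j=1..m. norm (g j)) * \<bar>K0\<bar>"
      using that K0[of u] by (intro mult_mono member_le_sum sum_nonneg) auto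
    finally show ?thesis by (simp add: K_def)
  qed
  define S where "S = (\<Sum>j=1..m. \<bar>b j\<bar>)"
  have S: "S \<ge> 0" by (simp add: S_def sum_nonneg)
  \<comment> \<open>Chosen so that the total error \<open>S * exp (2 * K - c)\<close> equals
    \<open>S * e / (S + 1)\<close>, which is below \<open>e\<close> even when
    \<open>S = 0\<close>.\<close>
  define c where "c = 2 * K - ln (e / (S + 1))"
  have expc: "exp (2 * K - c) = e / (S + 1)"
    using e S by (simp add: c_def)
  \<comment> \<open>At least one neuron is required, since the maximum in the sieve must range over
    a nonempty set.\<close>
  define r0 where "r0 = max 1 m"
  define V0 where "V0 = (\<Sum>j=1..m. \<bar>b j * exp c\<bar>)"
  define W0 where "W0 = (\<Sum>j=1..m. \<bar>c\<bar> + (\<Sum>i\<in>UNIV. \<bar>g j $ i\<bar>))"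
  show ?thesis
  proof (rule that)
    fix r :: nat and V W :: real
    assume r: "r \<ge> r0" and V: "V \<ge> V0" and W: "W \<ge> W0"
    define c' where "c' j = (if j \<in> {1..m} then - c else 0)" for j
    define h where "h = (\<lambda>u. b 0 * exp c + (\<Sum>j=1..r. b j * exp c * sigmoid (g j \<bullet> u + c' j)))"
    have sub: "{1..m} \<subseteq> {1..r}" "{1..r} \<noteq> {}" using r by (auto simp: r0_def)
    have b0: "b j = 0" if "j \<notin> {1..m}" for j using that by (auto simp: b_def)
    have "h \<in> nn_sieve r V W"
    proof -
      have "(\<Sum>j=0..r. \<bar>b j * exp c\<bar>) = V0"
        unfolding V0_def using sub b0 by (intro sum.mono_neutral_right) auto
      moreover have "(MAX j\<in>{1..r}. \<bar>c' j\<bar> + (\<Sum>i\<in>UNIV. \<bar>g j $ i\<bar>)) \<le> W0"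
      proof (rule Max.boundedI)
        fix a assume "a \<in> (\<lambda>j. \<bar>c' j\<bar> + (\<Sum>i\<in>UNIV. \<bar>g j $ i\<bar>)) ` {1..r}"
        then obtain j where a: "a = \<bar>c' j\<bar> + (\<Sum>i\<in>UNIV. \<bar>g j $ i\<bar>)" by auto
        show "a \<le> W0"
        proof (cases "j \<in> {1..m}")
          case True
          then have "a = \<bar>c\<bar> + (\<Sum>i\<in>UNIV. \<bar>g j $ i\<bar>)" by (simp add: a c'_def)
          also have "\<dots> \<le> W0"
            unfolding W0_def using True
            by (intro member_le_sum[of j _ "\<lambda>j. \<bar>c\<bar> + (\<Sum>i\<in>UNIV. \<bar>g j $ i\<bar>)"])
              (auto intro!: add_nonneg_nonneg sum_nonneg)
          finally show ?thesis .
        next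
          case False
          then have "c' j = 0" "g j = 0" by (auto simp: c'_def g_def)
          then have "a = 0" by (simp add: a)
          also have "0 \<le> W0"
            unfolding W0_def by (intro sum_nonneg add_nonneg_nonneg) auto
          finally show ?thesis .
        qed
      qed (use sub in auto)
      ultimately show ?thesis
        unfolding nn_sieve_def mem_Collect_eq using V W
        by (intro exI[of _ "\<lambda>j. b j * exp c"] exI[of _ g] exI[of _ c']) (auto simp: h_def)
    qed
    moreover have "\<bar>h u - exp_sum ps u\<bar> < e" if u: "u \<in> X" for u
    proof -
      have "h u = (\<Sum>j=1..r. b j * exp c * sigmoid (g j \<bullet> u + c' j))"
        using b0[of 0] by (simp add: h_def)
      also have "\<dots> = (\<Sum>j=1..m. b j * exp c * sigmoid (g j \<bullet> u + c' j))"
        using sub b0 by (intro sum.mono_neutral_right) auto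
      also have "\<dots> = (\<Sum>j=1..m. b j * (exp c * sigmoid (g j \<bullet> u - c)))"
        by (intro sum.cong) (auto simp: c'_def)
      finally have "h u - exp_sum ps u
          = (\<Sum>j=1..m. b j * (exp c * sigmoid (g j \<bullet> u - c) - exp (g j \<bullet> u)))"
        by (simp add: es right_diff_distrib sum_subtractf)
      also have "\<bar>\<dots>\<bar> \<le> (\<Sum>j=1..m. \<bar>b j * (exp c * sigmoid (g j \<bullet> u - c) - exp (g j \<bullet> u))\<bar>)"
        by (rule sum_abs)
      also have "\<dots> \<le> (\<Sum>j=1..m. \<bar>b j\<bar> * exp (2 * K - c))"
      proof (rule sum_mono)
        fix j assume j: "j \<in> {1..m}"
        have "\<bar>exp c * sigmoid (g j \<bullet> u - c) - exp (g j \<bullet> u)\<bar> \<le> exp (2 * (g j \<bullet> u) - c)"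
          by (rule sigmoid_exp_approx)
        also have "\<dots> \<le> exp (2 * K - c)" using K[OF j u] by simp
        finally show "\<bar>b j * (exp c * sigmoid (g j \<bullet> u - c) - exp (g j \<bullet> u))\<bar>
            \<le> \<bar>b j\<bar> * exp (2 * K - c)"
          by (simp add: abs_mult mult_left_mono)
      qed
      also have "\<dots> = S * e / (S + 1)"
        by (simp only: expc S_def sum_distrib_right) (simp add: sum_divide_distrib)
      also have "\<dots> < e" using e S by (simp add: field_simps)
      finally show ?thesis .
    qed
    ultimately show "\<exists>g\<in>nn_sieve r V W. \<forall>u\<in>X. \<bar>g u - exp_sum ps u\<bar> < e" by blast
  qed
qed

lemma nn_sieve_universal_approximation:
  fixes X :: "(real ^ 'd) set"
  assumes X: "compact X" and f: "continuous_on X f" and e: "0 < e"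
  obtains r0 V0 W0 where
    "\<And>r V W. r \<ge> r0 \<Longrightarrow> V \<ge> V0 \<Longrightarrow> W \<ge> W0 \<Longrightarrow>
       \<exists>g\<in>nn_sieve r V W. \<forall>u\<in>X. \<bar>g u - f u\<bar> < e"
proof -
  obtain ps where ps: "\<And>u. u \<in> X \<Longrightarrow> \<bar>f u - exp_sum ps u\<bar> < e / 2"
    using exp_sum_dense[OF X f, of "e / 2"] e by auto
  obtain r0 V0 W0 where *: "\<And>r V W. r \<ge> r0 \<Longrightarrow> V \<ge> V0 \<Longrightarrow> W \<ge> W0 \<Longrightarrow>
       \<exists>g\<in>nn_sieve r V W. \<forall>u\<in>X. \<bar>g u - exp_sum ps u\<bar> < e / 2"
    using exp_sum_approx_nn_sieve[OF compact_imp_bounded[OF X], of "e / 2" ps] e half_gt_zero by blast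
  show ?thesis
  proof (rule that)
    fix r :: nat and V W :: real
    assume "r \<ge> r0" "V \<ge> V0" "W \<ge> W0"
    then obtain g where g: "g \<in> nn_sieve r V W" "\<forall>u\<in>X. \<bar>g u - exp_sum ps u\<bar> < e / 2"
      using * by blast
    have "\<bar>g u - f u\<bar> < e" if "u \<in> X" for u
      using ps[OF that] g(2) that by (smt (verit) field_sum_of_halves)
    then show "\<exists>g\<in>nn_sieve r V W. \<forall>u\<in>X. \<bar>g u - f u\<bar> < e" using g(1) by blast
  qed
qed

subsection \<open>Maxima of partial sums of the noise\<close>

text \<open>This replaces exponential moments of small bounded variables by their first two moments
  in the Chernoff bound.\<close>

lemma exp_le_quadratic:
  fixes u :: real
  assumes "\<bar>u\<bar> \<le> 1"
  shows "exp u \<le> 1 + u + u\<^sup>2"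
proof (cases "u \<ge> 0")
  case True
  then show ?thesis using assms by (intro exp_bound) auto
next
  case False
  \<comment> \<open>For negative \<open>u\<close> the aim is
    \<open>1 \<le> (1 + u + u\<^sup>2) * exp (- u)\<close>. With the quadratic Taylor polynomial in
    place of \<open>exp (- u)\<close>, the right-hand side is 1 plus this expression.\<close>
  have "0 \<le> u\<^sup>2 / 2 - u ^ 3 / 2 + u ^ 4 / 2"
  proof -
    have "u\<^sup>2 / 2 - u ^ 3 / 2 + u ^ 4 / 2 = u\<^sup>2 / 2 * (1 - u + u\<^sup>2)"
      by (simp add: power2_eq_square power3_eq_cube power4_eq_xxxx algebra_simps)
    moreover have "0 \<le> u\<^sup>2 / 2 * (1 - u + u\<^sup>2)" using False by simp
    ultimately show ?thesis by simp
  qed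
  moreover have "(1 + u + u\<^sup>2) * (1 - u + u\<^sup>2 / 2) = 1 + (u\<^sup>2 / 2 - u ^ 3 / 2 + u ^ 4 / 2)"
    by (simp add: power2_eq_square power3_eq_cube power4_eq_xxxx field_simps)
  ultimately have "1 \<le> (1 + u + u\<^sup>2) * (1 - u + u\<^sup>2 / 2)"
    by simp
  also have "\<dots> \<le> (1 + u + u\<^sup>2) * exp (- u)"
  proof (rule mult_left_mono)
    show "1 - u + u\<^sup>2 / 2 \<le> exp (- u)"
      using exp_lower_Taylor_quadratic[of "- u"] False by simp
    show "0 \<le> 1 + u + u\<^sup>2" using assms by (simp add: abs_le_iff)
  qed
  finally have "1 * exp u \<le> (1 + u + u\<^sup>2) * exp (- u) * exp u"
    by (intro mult_right_mono) auto
  then show ?thesis by (simp add: mult.assoc flip: exp_add)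
qed

text \<open>Chernoff's bound with a free parameter \<open>l\<close>; \<open>l * b \<le> 1\<close>
  keeps \<open>l * Z i\<close> in the range of the quadratic bound on the exponential. The variables
  are not assumed centred: \<open>m\<close> will absorb the drift caused by truncation.\<close>

lemma (in prob_space) prob_sum_bounded_ge:
  fixes Z :: "'i \<Rightarrow> 'a \<Rightarrow> real"
  assumes indep: "indep_vars (\<lambda>_. borel) Z A" and A: "finite A"
    and b: "\<And>i \<omega>. i \<in> A \<Longrightarrow> \<bar>Z i \<omega>\<bar> \<le> b" and l: "0 < l" "l * b \<le> 1"
    and m: "\<And>i. i \<in> A \<Longrightarrow> expectation (Z i) \<le> m"
    and s: "\<And>i. i \<in> A \<Longrightarrow> expectation (\<lambda>\<omega>. (Z i \<omega>)\<^sup>2) \<le> s"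
  shows "prob {\<omega>\<in>space M. a \<le> (\<Sum>i\<in>A. Z i \<omega>)} \<le> exp (- l * a + real (card A) * (l * m + l\<^sup>2 * s))"
proof -
  have rv [measurable]: "Z i \<in> borel_measurable M" if "i \<in> A" for i
    using indep that by (auto simp: indep_vars_def)
  have lZ: "\<bar>l * Z i \<omega>\<bar> \<le> 1" if "i \<in> A" for i \<omega>
  proof -
    have "\<bar>l * Z i \<omega>\<bar> = l * \<bar>Z i \<omega>\<bar>" using l by (simp add: abs_mult)
    also have "\<dots> \<le> l * b" using l b[OF that] by (intro mult_left_mono) auto
    finally show ?thesis using l by simp
  qed
  have int: "integrable M (\<lambda>\<omega>. exp (l * Z i \<omega>))" "integrable M (Z i)"
      "integrable M (\<lambda>\<omega>. (Z i \<omega>)\<^sup>2)" if i: "i \<in> A" for i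
  proof -
    have "exp (l * Z i \<omega>) \<le> exp 1" for \<omega> using lZ[OF i, of \<omega>] by (simp add: abs_le_iff)
    then show "integrable M (\<lambda>\<omega>. exp (l * Z i \<omega>))"
      using i by (intro integrable_const_bound[where B = "exp 1"]) auto
    show "integrable M (Z i)"
      using i b by (intro integrable_const_bound[where B = b]) auto
    have "(Z i \<omega>)\<^sup>2 \<le> b\<^sup>2" for \<omega>
      using b[OF i, of \<omega>] by (metis abs_ge_zero power2_abs power_mono)
    then show "integrable M (\<lambda>\<omega>. (Z i \<omega>)\<^sup>2)"
      using i by (intro integrable_const_bound[where B = "b\<^sup>2"]) auto
  qed
  have indep': "indep_vars (\<lambda>_. borel) (\<lambda>i \<omega>. exp (l * Z i \<omega>)) A"
    by (rule indep_vars_compose2[OF indep]) auto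
  have E: "expectation (\<lambda>\<omega>. exp (l * Z i \<omega>)) \<le> exp (l * m + l\<^sup>2 * s)" if i: "i \<in> A" for i
  proof -
    have "expectation (\<lambda>\<omega>. exp (l * Z i \<omega>)) \<le> expectation (\<lambda>\<omega>. 1 + l * Z i \<omega> + l\<^sup>2 * (Z i \<omega>)\<^sup>2)"
      using int[OF i] exp_le_quadratic[OF lZ[OF i]]
      by (intro integral_mono) (auto simp: power_mult_distrib)
    also have "\<dots> = 1 + l * expectation (Z i) + l\<^sup>2 * expectation (\<lambda>\<omega>. (Z i \<omega>)\<^sup>2)"
      using int[OF i] by (simp add: prob_space)
    also have "\<dots> \<le> 1 + (l * m + l\<^sup>2 * s)"
      using m[OF i] s[OF i] l by (auto simp: add.assoc intro!: add_mono mult_left_mono)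
    also have "\<dots> \<le> exp (l * m + l\<^sup>2 * s)" by (rule exp_ge_add_one_self)
    finally show ?thesis .
  qed
  have intsum: "integrable M (\<lambda>\<omega>. exp (l * (\<Sum>i\<in>A. Z i \<omega>)))"
    using indep_vars_integrable[OF A indep'] int A by (simp add: exp_sum sum_distrib_left)
  have "prob {\<omega>\<in>space M. a \<le> (\<Sum>i\<in>A. Z i \<omega>)}
      \<le> exp (- l * a) * (\<integral>\<omega>\<in>space M. exp (l * (\<Sum>i\<in>A. Z i \<omega>)) \<partial>M)"
    using intsum l by (intro Chernoff_ineq_ge) (auto simp: set_integrable_def intro: integrable_mult_indicator[where 'b = real, simplified])
  also have "(\<integral>\<omega>\<in>space M. exp (l * (\<Sum>i\<in>A. Z i \<omega>)) \<partial>M) = expectation (\<lambda>\<omega>. exp (l * (\<Sum>i\<in>A. Z i \<omega>)))"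
    by (rule set_integral_space[OF intsum])
  also have "\<dots> = (\<Prod>i\<in>A. expectation (\<lambda>\<omega>. exp (l * Z i \<omega>)))"
    using indep_vars_lebesgue_integral[OF A indep'] int A by (simp add: exp_sum sum_distrib_left)
  also have "\<dots> \<le> (\<Prod>i\<in>A. exp (l * m + l\<^sup>2 * s))"
    using E by (intro prod_mono) (auto intro: integral_nonneg_AE)
  also have "\<dots> = exp (real (card A) * (l * m + l\<^sup>2 * s))"
    by (simp add: exp_of_nat_mult)
  finally show ?thesis by (simp add: mult_exp_exp)
qed

text \<open>Large values are set to 0 rather than capped: beyond \<open>v\<close> the remainder is
  then \<open>t\<close> itself, and \<open>v * \<bar>t\<bar>\<close> is at most
  \<open>t\<^sup>2\<close>.\<close>

definition clip0 :: "real \<Rightarrow> real \<Rightarrow> real" where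
  "clip0 v t = (if \<bar>t\<bar> \<le> v then t else 0)"

text \<open>Dominated by the square and zero once \<open>v\<close> reaches
  \<open>\<bar>t\<bar>\<close>, so for square-integrable noise its expectation vanishes as
  \<open>v\<close> grows.\<close>

definition tail_sq :: "real \<Rightarrow> real \<Rightarrow> real" where
  "tail_sq v t = (if \<bar>t\<bar> \<le> v then 0 else t\<^sup>2)"

lemma measurable_clip0 [measurable]: "clip0 v \<in> borel_measurable borel"
  unfolding clip0_def by measurable

lemma measurable_tail_sq [measurable]: "tail_sq v \<in> borel_measurable borel"
  unfolding tail_sq_def by measurable

lemma tail_sq_nonneg: "0 \<le> tail_sq v t"
  by (simp add: tail_sq_def)

lemma clip0_error:
  assumes "0 \<le> v"
  shows "v * \<bar>t - clip0 v t\<bar> \<le> tail_sq v t"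
proof (cases "\<bar>t\<bar> \<le> v")
  case False
  then have "v * \<bar>t\<bar> \<le> \<bar>t\<bar> * \<bar>t\<bar>" by (intro mult_right_mono) auto
  then show ?thesis using False by (simp add: clip0_def tail_sq_def power2_eq_square)
qed (simp add: clip0_def tail_sq_def)

lemma (in prob_space) prob_exists_le:
  assumes H: "finite H" and ev: "\<And>A. A \<in> H \<Longrightarrow> E A \<in> events"
    and p: "\<And>A. A \<in> H \<Longrightarrow> prob (E A) \<le> p"
  shows "prob (\<Union>A\<in>H. E A) \<le> real (card H) * p"
proof -
  have "prob (\<Union>A\<in>H. E A) \<le> (\<Sum>A\<in>H. prob (E A))"
    using H ev by (intro finite_measure_subadditive_finite) auto
  also have "\<dots> \<le> (\<Sum>A\<in>H. p)" by (rule sum_mono[OF p])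
  finally show ?thesis by simp
qed

text \<open>The noise only has a second moment: it is truncated at level \<open>v\<close>, which makes \<open>l = \<delta> / v\<close>
  an admissible Chernoff parameter and bounds \<open>v\<close> times the remainder by \<open>tail_sq v\<close>.\<close>

lemma (in prob_space) prob_max_partial_sum_gt:
  fixes eps :: "nat \<Rightarrow> 'a \<Rightarrow> real"
  assumes indep: "indep_vars (\<lambda>_. borel) eps {1..}"
    and sq: "\<And>i. i \<ge> 1 \<Longrightarrow> integrable M (\<lambda>\<omega>. (eps i \<omega>)\<^sup>2)"
    and mean: "\<And>i. i \<ge> 1 \<Longrightarrow> expectation (eps i) = 0"
    and s: "\<And>i. i \<ge> 1 \<Longrightarrow> expectation (\<lambda>\<omega>. (eps i \<omega>)\<^sup>2) \<le> s"
    and tau: "\<And>i. i \<ge> 1 \<Longrightarrow> expectation (\<lambda>\<omega>. tail_sq v (eps i \<omega>)) \<le> \<tau>"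
    and H: "H \<subseteq> Pow {1..n}" and v: "0 < v" and t: "0 < t"
    and \<delta>: "0 < \<delta>" "\<delta> \<le> 1" "\<delta> * s \<le> t / 8" and \<tau>: "\<tau> \<le> t / 8" and n: "1 \<le> n"
  shows "prob {\<omega>\<in>space M. \<exists>A\<in>H. v * \<bar>\<Sum>i\<in>A. eps i \<omega>\<bar> > real n * t}
    \<le> 2 * real (card H) * exp (- (real n / v\<^sup>2) * (\<delta> * t / 4)) + 2 * \<tau> / t"
proof -
  have finH: "finite H" using H finite_subset by fastforce
  have rv: "eps i \<in> borel_measurable M" if "i \<ge> 1" for i
    using indep that by (auto simp: indep_vars_def)
  \<comment> \<open>The signs 1 and -1 for \<open>\<sigma>\<close> cover the two tails of the
    absolute value. The level \<open>a\<close> below is half of \<open>real n * t / v\<close>; the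
    other half is left to the truncation remainder.\<close>
  define c where "c \<sigma> i \<omega> = \<sigma> * clip0 v (eps i \<omega>)" for \<sigma> :: real and i \<omega>
  define a where "a = real n * t / (2 * v)"
  have s0: "0 \<le> s" using s[of 1] by (intro order_trans[OF _ s[of 1]] integral_nonneg_AE) auto
  have \<tau>0: "0 \<le> \<tau>"
    by (intro order_trans[OF _ tau[of 1]] integral_nonneg_AE) (auto simp: tail_sq_nonneg)
  have intt: "integrable M (\<lambda>\<omega>. tail_sq v (eps i \<omega>))" if i: "i \<ge> 1" for i
    using rv[OF i] by (intro Bochner_Integration.integrable_bound[OF sq[OF i]])
      (auto simp: tail_sq_def)
  have inte: "integrable M (eps i)" if i: "i \<ge> 1" for i
    by (rule square_integrable_imp_integrable[OF rv[OF i] sq[OF i]])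
  have intc: "integrable M (\<lambda>\<omega>. clip0 v (eps i \<omega>))" if i: "i \<ge> 1" for i
    using rv[OF i] v by (intro integrable_const_bound[where B = v]) (auto simp: clip0_def)
  \<comment> \<open>Since the noise is centred, the mean of its truncation is minus the mean of the
    remainder.\<close>
  have clip_mean: "\<bar>expectation (\<lambda>\<omega>. clip0 v (eps i \<omega>))\<bar> \<le> \<tau> / v" if i: "i \<ge> 1" for i
  proof -
    have "\<bar>expectation (\<lambda>\<omega>. clip0 v (eps i \<omega>))\<bar> = \<bar>expectation (\<lambda>\<omega>. eps i \<omega> - clip0 v (eps i \<omega>))\<bar>"
      using inte[OF i] intc[OF i] mean[OF i] by simp
    also have "\<dots> \<le> expectation (\<lambda>\<omega>. \<bar>eps i \<omega> - clip0 v (eps i \<omega>)\<bar>)"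
      by (rule integral_abs_bound)
    also have "\<dots> \<le> expectation (\<lambda>\<omega>. tail_sq v (eps i \<omega>) / v)"
      using inte[OF i] intc[OF i] intt[OF i] clip0_error[of v] v
      by (intro integral_mono) (auto simp: field_simps)
    also have "\<dots> \<le> \<tau> / v"
      using tau[OF i] v by (simp add: divide_right_mono)
    finally show ?thesis .
  qed
  have bnd: "prob {\<omega>\<in>space M. a \<le> (\<Sum>i\<in>A. c \<sigma> i \<omega>)} \<le> exp (- (real n / v\<^sup>2) * (\<delta> * t / 4))"
    if \<sigma>: "\<bar>\<sigma>\<bar> = 1" and A: "A \<in> H" for \<sigma> A
  proof -
    have A1: "A \<subseteq> {1..n}" using A H by auto
    then have finA: "finite A" and cardA: "card A \<le> n"
      using finite_subset[of A "{1..n}"] card_mono[of "{1..n}" A] by auto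
    have Age: "i \<ge> 1" if "i \<in> A" for i using A1 that by auto
    have "indep_vars (\<lambda>_. borel) eps A"
      by (rule indep_vars_subset[OF indep]) (use Age in auto)
    then have ind: "indep_vars (\<lambda>_. borel) (c \<sigma>) A"
      unfolding c_def by (rule indep_vars_compose2) measurable
    have "prob {\<omega>\<in>space M. a \<le> (\<Sum>i\<in>A. c \<sigma> i \<omega>)}
        \<le> exp (- (\<delta> / v) * a + real (card A) * ((\<delta> / v) * (\<tau> / v) + (\<delta> / v)\<^sup>2 * s))"
    proof (rule prob_sum_bounded_ge[OF ind finA, where b = v])
      show "\<bar>c \<sigma> i \<omega>\<bar> \<le> v" for i \<omega>
        using \<sigma> v by (simp add: c_def abs_mult clip0_def)
      show "expectation (c \<sigma> i) \<le> \<tau> / v" if "i \<in> A" for i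
      proof -
        have "expectation (c \<sigma> i) \<le> \<bar>\<sigma> * expectation (\<lambda>\<omega>. clip0 v (eps i \<omega>))\<bar>"
          unfolding c_def by simp
        also have "\<dots> \<le> \<tau> / v" using clip_mean[OF Age[OF that]] \<sigma> by (simp add: abs_mult)
        finally show ?thesis .
      qed
      show "expectation (\<lambda>\<omega>. (c \<sigma> i \<omega>)\<^sup>2) \<le> s" if "i \<in> A" for i
      proof -
        have \<sigma>2: "\<sigma>\<^sup>2 = 1" using \<sigma> by (metis power2_abs power_one)
        have "expectation (\<lambda>\<omega>. (c \<sigma> i \<omega>)\<^sup>2) \<le> expectation (\<lambda>\<omega>. (eps i \<omega>)\<^sup>2)"
          using sq[OF Age[OF that]] \<sigma>2
          by (intro integral_mono') (auto simp: c_def power_mult_distrib clip0_def)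
        then show ?thesis using s[OF Age[OF that]] by simp
      qed
    qed (use \<delta> v in auto)
    also have "\<dots> \<le> exp (- (real n / v\<^sup>2) * (\<delta> * t / 4))"
    proof -
      \<comment> \<open>In units of \<open>real n / v\<^sup>2\<close>, the threshold contributes
        \<open>- \<delta> * t / 2\<close> to the exponent, while drift and second moment cost at
        most \<open>\<delta> * t / 8\<close> each; \<open>- \<delta> * t / 4\<close>
        remains.\<close>
      have "real (card A) * ((\<delta> / v) * (\<tau> / v) + (\<delta> / v)\<^sup>2 * s)
          \<le> real n * ((\<delta> / v) * (\<tau> / v) + (\<delta> / v)\<^sup>2 * s)"
        using cardA \<delta> v \<tau>0 s0 by (intro mult_right_mono) auto
      also have "\<dots> = real n / v\<^sup>2 * (\<delta> * (\<tau> + \<delta> * s))"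
        using v by (simp add: power2_eq_square field_simps)
      also have "\<dots> \<le> real n / v\<^sup>2 * (\<delta> * (t / 4))"
        using \<delta> \<tau> by (intro mult_left_mono) auto
      finally have "- (\<delta> / v) * a + real (card A) * ((\<delta> / v) * (\<tau> / v) + (\<delta> / v)\<^sup>2 * s)
          \<le> - (\<delta> / v) * a + real n / v\<^sup>2 * (\<delta> * (t / 4))" by simp
      also have "\<dots> = - (real n / v\<^sup>2) * (\<delta> * t / 4)"
        using v by (simp add: a_def power2_eq_square field_simps)
      finally show ?thesis by simp
    qed
    finally show ?thesis .
  qed
  have evc: "{\<omega>\<in>space M. a \<le> (\<Sum>i\<in>A. c \<sigma> i \<omega>)} \<in> events" if "A \<in> H" for \<sigma> A
  proof -
    have [measurable]: "c \<sigma> i \<in> borel_measurable M" if "i \<in> A" for i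
    proof -
      have [measurable]: "eps i \<in> borel_measurable M" using H \<open>A \<in> H\<close> that by (intro rv) force
      show ?thesis unfolding c_def by measurable
    qed
    show ?thesis by measurable
  qed
  define P where "P \<sigma> = (\<Union>A\<in>H. {\<omega>\<in>space M. a \<le> (\<Sum>i\<in>A. c \<sigma> i \<omega>)})" for \<sigma>
  \<comment> \<open>One event controls the remainder for all index sets at once, because
    \<open>tail_sq\<close> is nonnegative and its sum over \<open>A\<close> is at most the sum over
    \<open>{1..n}\<close>. Markov's inequality suffices here.\<close>
  define Q where "Q = {\<omega>\<in>space M. (\<Sum>i=1..n. tail_sq v (eps i \<omega>)) \<ge> real n * t / 2}"
  have evP: "P \<sigma> \<in> events" for \<sigma>
    unfolding P_def using evc finH by (intro sets.finite_UN) auto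
  have intS: "integrable M (\<lambda>\<omega>. \<Sum>i=1..n. tail_sq v (eps i \<omega>))"
    using intt by (intro Bochner_Integration.integrable_sum) auto
  have evQ: "Q \<in> events"
    unfolding Q_def using intS by measurable
  have PP: "prob (P \<sigma>) \<le> real (card H) * exp (- (real n / v\<^sup>2) * (\<delta> * t / 4))" if "\<bar>\<sigma>\<bar> = 1" for \<sigma>
    unfolding P_def using finH evc bnd[OF that] by (intro prob_exists_le)
  have PQ: "prob Q \<le> 2 * \<tau> / t"
  proof -
    have "prob Q \<le> expectation (\<lambda>\<omega>. \<Sum>i=1..n. tail_sq v (eps i \<omega>)) / (real n * t / 2)"
      unfolding Q_def using n t intS
      by (intro integral_Markov_inequality_measure[where A = "{}"]) (auto intro!: sum_nonneg simp: tail_sq_nonneg)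
    also have "expectation (\<lambda>\<omega>. \<Sum>i=1..n. tail_sq v (eps i \<omega>))
        = (\<Sum>i=1..n. expectation (\<lambda>\<omega>. tail_sq v (eps i \<omega>)))"
      using intt by (intro Bochner_Integration.integral_sum) auto
    also have "\<dots> \<le> (\<Sum>i=1..n. \<tau>)" by (intro sum_mono tau) auto
    also have "(\<Sum>i=1..n. \<tau>) / (real n * t / 2) = 2 * \<tau> / t"
      using n by simp
    finally show ?thesis using n t by (simp add: divide_right_mono)
  qed
  have "{\<omega>\<in>space M. \<exists>A\<in>H. v * \<bar>\<Sum>i\<in>A. eps i \<omega>\<bar> > real n * t} \<subseteq> (P 1 \<union> P (-1)) \<union> Q"
  proof
    fix \<omega> assume "\<omega> \<in> {\<omega>\<in>space M. \<exists>A\<in>H. v * \<bar>\<Sum>i\<in>A. eps i \<omega>\<bar> > real n * t}"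
    then obtain A where \<omega>: "\<omega> \<in> space M" and A: "A \<in> H"
      and gt: "v * \<bar>\<Sum>i\<in>A. eps i \<omega>\<bar> > real n * t" by auto
    have A1: "A \<subseteq> {1..n}" using A H by auto
    show "\<omega> \<in> (P 1 \<union> P (-1)) \<union> Q"
    proof (cases "\<omega> \<in> Q")
      case False
      have "v * \<bar>(\<Sum>i\<in>A. eps i \<omega>) - (\<Sum>i\<in>A. clip0 v (eps i \<omega>))\<bar>
          \<le> v * (\<Sum>i\<in>A. \<bar>eps i \<omega> - clip0 v (eps i \<omega>)\<bar>)"
        unfolding sum_subtractf[symmetric] using v by (intro mult_left_mono sum_abs) auto
      also have "\<dots> \<le> (\<Sum>i\<in>A. tail_sq v (eps i \<omega>))"
        unfolding sum_distrib_left using v by (intro sum_mono clip0_error) auto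
      also have "\<dots> \<le> (\<Sum>i=1..n. tail_sq v (eps i \<omega>))"
        using A1 by (intro sum_mono2) (auto simp: tail_sq_nonneg)
      also have "\<dots> < real n * t / 2" using False \<omega> by (auto simp: Q_def)
      finally have "v * \<bar>(\<Sum>i\<in>A. eps i \<omega>) - (\<Sum>i\<in>A. clip0 v (eps i \<omega>))\<bar> < real n * t / 2" .
      moreover have "v * \<bar>\<Sum>i\<in>A. eps i \<omega>\<bar> \<le> v * \<bar>\<Sum>i\<in>A. clip0 v (eps i \<omega>)\<bar>
          + v * \<bar>(\<Sum>i\<in>A. eps i \<omega>) - (\<Sum>i\<in>A. clip0 v (eps i \<omega>))\<bar>"
        unfolding distrib_left[symmetric] using v by (intro mult_left_mono) auto
      ultimately have "real n * t / 2 < v * \<bar>\<Sum>i\<in>A. clip0 v (eps i \<omega>)\<bar>" using gt by linarith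
      then have "a < \<bar>\<Sum>i\<in>A. clip0 v (eps i \<omega>)\<bar>"
        using v by (simp add: a_def field_simps)
      then have "a \<le> (\<Sum>i\<in>A. c 1 i \<omega>) \<or> a \<le> (\<Sum>i\<in>A. c (-1) i \<omega>)"
        by (auto simp: c_def sum_negf)
      then show ?thesis using A \<omega> by (auto simp: P_def)
    qed simp
  qed
  then have "prob {\<omega>\<in>space M. \<exists>A\<in>H. v * \<bar>\<Sum>i\<in>A. eps i \<omega>\<bar> > real n * t} \<le> prob ((P 1 \<union> P (-1)) \<union> Q)"
    using evP evQ by (intro finite_measure_mono) auto
  also have "\<dots> \<le> prob (P 1 \<union> P (-1)) + prob Q"
    using evP evQ by (intro measure_Un_le) auto
  also have "prob (P 1 \<union> P (-1)) \<le> prob (P 1) + prob (P (-1))"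
    using evP by (intro measure_Un_le)
  finally show ?thesis using PP[of 1] PP[of "-1"] PQ by simp
qed

text \<open>If \<open>V n \<ge> n powr (1/4)\<close> then \<open>ln n\<close> is at most \<open>4 * ln (V n)\<close>; otherwise \<open>(V n)\<^sup>2\<close> is at most
  \<open>sqrt n\<close>.\<close>

lemma square_mult_ln_eventually_le:
  fixes V K :: "nat \<Rightarrow> real"
  assumes V: "\<And>n. n \<ge> 1 \<Longrightarrow> V n \<ge> 1" and K: "\<And>n. n \<ge> 1 \<Longrightarrow> K n \<ge> 1"
    and o: "(\<lambda>n. K n * (V n)\<^sup>2 * ln (V n * K n)) \<in> o(\<lambda>n. real n)" and c: "0 < c"
  shows "\<forall>\<^sub>F n in sequentially. (V n)\<^sup>2 * ln (real n) \<le> c * real n"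
proof -
  \<comment> \<open>The constant \<open>c / 4\<close> offsets the factor 4 in the logarithm of the
    fourth power of \<open>V n\<close>.\<close>
  have "\<forall>\<^sub>F n in sequentially. norm (K n * (V n)\<^sup>2 * ln (V n * K n)) \<le> c / 4 * norm (real n)"
    using landau_o.smallD[OF o, of "c / 4"] c by simp
  moreover have "\<forall>\<^sub>F n in sequentially. sqrt (real n) * ln (real n) \<le> c * real n"
    using c by real_asymp
  moreover have "\<forall>\<^sub>F n in sequentially. n \<ge> (1::nat)" by (rule eventually_ge_at_top)
  ultimately show ?thesis
  proof eventually_elim
    case (elim n)
    have Vn: "V n \<ge> 1" and Kn: "K n \<ge> 1" using V K elim by auto
    have n: "real n \<ge> 1" using elim by simp
    show ?case
    proof (cases "real n \<le> V n ^ 4")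
      case True
      have "ln (real n) \<le> ln (V n ^ 4)" using True n Vn by (intro ln_mono) auto
      also have "\<dots> = 4 * ln (V n)" using Vn by (simp add: ln_realpow)
      finally have "(V n)\<^sup>2 * ln (real n) \<le> (V n)\<^sup>2 * (4 * ln (V n))" by (intro mult_left_mono) auto
      also have "\<dots> \<le> 4 * (1 * (V n)\<^sup>2 * ln (V n))" by simp
      also have "1 * (V n)\<^sup>2 * ln (V n) \<le> K n * (V n)\<^sup>2 * ln (V n * K n)"
      proof (intro mult_mono)
        have "V n * 1 \<le> V n * K n" using Vn Kn by (intro mult_left_mono) auto
        then show "ln (V n) \<le> ln (V n * K n)" using Vn by (intro ln_mono) auto
      qed (use Vn Kn in auto)
      also have "K n * (V n)\<^sup>2 * ln (V n * K n) \<le> norm (K n * (V n)\<^sup>2 * ln (V n * K n))" by simp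
      also have "\<dots> \<le> c / 4 * norm (real n)" using elim by simp
      finally show ?thesis by simp
    next
      case False
      have "(V n)\<^sup>2 = sqrt (V n ^ 4)"
        by (rule real_sqrt_unique[symmetric]) auto
      also have "\<dots> \<le> sqrt (real n)" using False by simp
      finally have "(V n)\<^sup>2 * ln (real n) \<le> sqrt (real n) * ln (real n)"
        using n by (intro mult_right_mono) auto
      then show ?thesis using elim by linarith
    qed
  qed
qed

lemma (in prob_space) expectation_eq_of_distr_eq:
  fixes h :: "real \<Rightarrow> real"
  assumes "f \<in> borel_measurable M" "g \<in> borel_measurable M" "h \<in> borel_measurable borel"
    and "distr M borel f = distr M borel g"
  shows "expectation (\<lambda>\<omega>. h (f \<omega>)) = expectation (\<lambda>\<omega>. h (g \<omega>))"
  using integral_distr[OF assms(1,3)] integral_distr[OF assms(2,3)] assms(4) by simp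

text \<open>The union bound costs a factor polynomial in \<open>n\<close> of degree
  \<open>D\<close>. By the growth condition, taken with constant \<open>q / (real D + 1)\<close>,
  the Chernoff factor is at most \<open>1 / real n ^ (D + 1)\<close>, so the product is of order
  \<open>1 / real n\<close>.\<close>

lemma (in prob_space) max_partial_sum_tendsto_0:
  fixes eps :: "nat \<Rightarrow> 'a \<Rightarrow> real" and H :: "nat \<Rightarrow> nat set set"
  assumes indep: "indep_vars (\<lambda>_. borel) eps {1..}"
    and ident: "\<And>i j. i \<ge> 1 \<Longrightarrow> j \<ge> 1 \<Longrightarrow> distr M borel (eps i) = distr M borel (eps j)"
    and sq: "\<And>i. i \<ge> 1 \<Longrightarrow> integrable M (\<lambda>\<omega>. (eps i \<omega>)\<^sup>2)"
    and mean: "\<And>i. i \<ge> 1 \<Longrightarrow> expectation (eps i) = 0"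
    and V: "\<And>n. n \<ge> 1 \<Longrightarrow> V n > 0" "filterlim V at_top sequentially"
    and growth: "\<And>c. 0 < c \<Longrightarrow> \<forall>\<^sub>F n in sequentially. (V n)\<^sup>2 * ln (real n) \<le> c * real n"
    and H: "\<And>n. H n \<subseteq> Pow {1..n}" "\<And>n. card (H n) \<le> (n + 1) ^ D"
    and t: "0 < t"
  shows "(\<lambda>n. prob {\<omega>\<in>space M. \<exists>A\<in>H n. V n * \<bar>\<Sum>i\<in>A. eps i \<omega>\<bar> > real n * t}) \<longlonglongrightarrow> 0"
proof -
  have rv: "eps i \<in> borel_measurable M" if "i \<ge> 1" for i
    using indep that by (auto simp: indep_vars_def)
  have [measurable]: "eps (Suc 0) \<in> borel_measurable M" by (rule rv) simp
  define s where "s = expectation (\<lambda>\<omega>. (eps 1 \<omega>)\<^sup>2)"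
  define \<tau> where "\<tau> n = expectation (\<lambda>\<omega>. tail_sq (V n) (eps 1 \<omega>))" for n
  have s0: "s \<ge> 0" by (simp add: s_def)
  have s: "expectation (\<lambda>\<omega>. (eps i \<omega>)\<^sup>2) = s" if "i \<ge> 1" for i
    unfolding s_def using expectation_eq_of_distr_eq[OF rv rv, of i 1 "\<lambda>t. t\<^sup>2"] ident that by simp
  have \<tau>: "expectation (\<lambda>\<omega>. tail_sq (V n) (eps i \<omega>)) = \<tau> n" if "i \<ge> 1" for i n
    unfolding \<tau>_def using expectation_eq_of_distr_eq[OF rv rv, of i 1 "tail_sq (V n)"] ident that
    by simp
  have \<tau>_lim: "\<tau> \<longlonglongrightarrow> 0"
  proof -
    have "(\<lambda>n. expectation (\<lambda>\<omega>. tail_sq (V n) (eps 1 \<omega>))) \<longlonglongrightarrow> expectation (\<lambda>\<omega>. 0)"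
    proof (rule integral_dominated_convergence[where w = "\<lambda>\<omega>. (eps 1 \<omega>)\<^sup>2"])
      show "AE \<omega> in M. (\<lambda>n. tail_sq (V n) (eps 1 \<omega>)) \<longlonglongrightarrow> 0"
      proof (rule AE_I2)
        fix \<omega>
        have "\<forall>\<^sub>F n in sequentially. V n \<ge> \<bar>eps 1 \<omega>\<bar>"
          using V(2) by (simp add: filterlim_at_top)
        then have "\<forall>\<^sub>F n in sequentially. tail_sq (V n) (eps 1 \<omega>) = 0"
          by eventually_elim (simp add: tail_sq_def)
        then show "(\<lambda>n. tail_sq (V n) (eps 1 \<omega>)) \<longlonglongrightarrow> 0" by (rule tendsto_eventually)
      qed
      show "integrable M (\<lambda>\<omega>. (eps 1 \<omega>)\<^sup>2)" by (rule sq) simp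
    qed (auto simp: tail_sq_def)
    then show ?thesis by (simp add: \<tau>_def[abs_def])
  qed
  \<comment> \<open>The minimum with 1 makes \<open>\<delta> / v\<close> admissible for noise
    truncated at \<open>v\<close>; the second entry keeps \<open>\<delta> * s\<close> below
    \<open>t / 8\<close>, with \<open>s + 1\<close> avoiding a zero denominator.\<close>
  define \<delta> where "\<delta> = min 1 (t / (8 * (s + 1)))"
  have \<delta>: "0 < \<delta>" "\<delta> \<le> 1" using t s0 by (auto simp: \<delta>_def)
  have \<delta>s: "\<delta> * s \<le> t / 8"
  proof -
    have "\<delta> * s \<le> t / (8 * (s + 1)) * s" using s0 by (intro mult_right_mono) (auto simp: \<delta>_def)
    also have "\<dots> \<le> t / 8" using s0 t by (simp add: field_simps)
    finally show ?thesis .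
  qed
  define q where "q = \<delta> * t / 4"
  have q: "q > 0" using \<delta> t by (simp add: q_def)
  have "\<forall>\<^sub>F n in sequentially. \<tau> n < t / 8"
    using \<tau>_lim t by (intro order_tendstoD) auto
  moreover have "\<forall>\<^sub>F n in sequentially. (V n)\<^sup>2 * ln (real n) \<le> q / (real D + 1) * real n"
    using q by (intro growth) auto
  moreover have "\<forall>\<^sub>F n in sequentially. n \<ge> (1::nat)" by (rule eventually_ge_at_top)
  ultimately have bound: "\<forall>\<^sub>F n in sequentially.
      prob {\<omega>\<in>space M. \<exists>A\<in>H n. V n * \<bar>\<Sum>i\<in>A. eps i \<omega>\<bar> > real n * t}
      \<le> 2 * 2 ^ D / real n + 2 * \<tau> n / t"
  proof eventually_elim
    case (elim n)
    have n: "real n \<ge> 1" using elim by simp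
    have Vn: "V n > 0" using V elim by auto
    have "prob {\<omega>\<in>space M. \<exists>A\<in>H n. V n * \<bar>\<Sum>i\<in>A. eps i \<omega>\<bar> > real n * t}
        \<le> 2 * real (card (H n)) * exp (- (real n / (V n)\<^sup>2) * (\<delta> * t / 4)) + 2 * \<tau> n / t"
      using s \<tau> elim Vn t \<delta> \<delta>s
      by (intro prob_max_partial_sum_gt[OF indep sq mean, where s = s] H(1)) auto
    also have "2 * real (card (H n)) * exp (- (real n / (V n)\<^sup>2) * (\<delta> * t / 4))
        \<le> 2 * (2 * real n) ^ D * (1 / real n ^ (D + 1))"
    proof (intro mult_mono)
      have "real (card (H n)) \<le> real ((n + 1) ^ D)" using H(2) by (simp only: of_nat_le_iff)
      also have "\<dots> \<le> (2 * real n) ^ D"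
        unfolding of_nat_power using n by (intro power_mono) auto
      finally show "real (card (H n)) \<le> (2 * real n) ^ D" .
      have "(real D + 1) * ln (real n) \<le> real n / (V n)\<^sup>2 * q"
        using elim(2) Vn by (simp add: field_simps)
      then have "exp (- (real n / (V n)\<^sup>2) * q) \<le> exp (- (real (D + 1) * ln (real n)))"
        by (simp add: add.commute)
      also have "\<dots> = 1 / real n ^ (D + 1)"
        using n by (simp only: exp_minus exp_of_nat_mult exp_ln inverse_eq_divide)
      finally show "exp (- (real n / (V n)\<^sup>2) * (\<delta> * t / 4)) \<le> 1 / real n ^ (D + 1)"
        by (simp add: q_def)
    qed auto
    also have "2 * (2 * real n) ^ D * (1 / real n ^ (D + 1)) = 2 * 2 ^ D / real n"
      using n by (simp add: power_mult_distrib)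
    finally show ?case by simp
  qed
  have "(\<lambda>n. 2 * 2 ^ D / real n + 2 * \<tau> n / t) \<longlonglongrightarrow> 0 + 2 * 0 / t"
    using \<tau>_lim t by (intro tendsto_intros lim_const_over_n) auto
  then show ?thesis
    by (intro real_tendsto_sandwich[OF _ bound tendsto_const]) auto
qed

section \<open>Negligible remainders and the basic inequality of least squares\<close>

lemma bigO_in_prob_tendsto_0:
  assumes R: "bigO_in_prob M R \<eta>" and \<eta>: "\<eta> \<longlonglongrightarrow> 0" and a: "0 < a" and "finite_measure M"
  shows "(\<lambda>n. measure M {\<omega>\<in>space M. \<bar>R n \<omega>\<bar> > a}) \<longlonglongrightarrow> 0"
proof (rule order_tendstoI)
  interpret finite_measure M by fact
  fix d :: real assume d: "0 < d"
  have [measurable]: "R n \<in> borel_measurable M" for n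
    using R by (simp add: bigO_in_prob_def)
  obtain C where C: "C > 0"
      "\<forall>\<^sub>F n in sequentially. measure M {\<omega>\<in>space M. \<bar>R n \<omega>\<bar> > C * \<bar>\<eta> n\<bar>} < d"
    using R d by (auto simp: bigO_in_prob_def)
  have "(\<lambda>n. C * \<bar>\<eta> n\<bar>) \<longlonglongrightarrow> C * \<bar>0\<bar>" using \<eta> by (intro tendsto_intros)
  then have "\<forall>\<^sub>F n in sequentially. C * \<bar>\<eta> n\<bar> < a"
    using a by (intro order_tendstoD) auto
  with C(2) show "\<forall>\<^sub>F n in sequentially. measure M {\<omega>\<in>space M. \<bar>R n \<omega>\<bar> > a} < d"
  proof eventually_elim
    case (elim n)
    have "measure M {\<omega>\<in>space M. \<bar>R n \<omega>\<bar> > a} \<le> measure M {\<omega>\<in>space M. \<bar>R n \<omega>\<bar> > C * \<bar>\<eta> n\<bar>}"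
      using elim by (intro finite_measure_mono) auto
    then show ?case using elim by simp
  qed
qed (auto intro!: always_eventually less_le_trans[OF _ measure_nonneg])

lemma emp_norm_sq: "(emp_norm x n f)\<^sup>2 = 1 / real n * (\<Sum>i=1..n. (f (x i))\<^sup>2)"
  unfolding emp_norm_def by (rule real_sqrt_pow2) (simp add: sum_nonneg)

lemma emp_risk_eq:
  assumes "\<And>i. i \<in> {1..n} \<Longrightarrow> y i = f0 (x i) + e i"
  shows "emp_risk x n y f = 1 / real n * (\<Sum>i=1..n. (e i)\<^sup>2)
    - 2 / real n * (\<Sum>i=1..n. e i * (f (x i) - f0 (x i))) + (emp_norm x n (\<lambda>u. f u - f0 u))\<^sup>2"
proof -
  have "(\<Sum>i=1..n. (y i - f (x i))\<^sup>2)
      = (\<Sum>i=1..n. (e i)\<^sup>2 - 2 * (e i * (f (x i) - f0 (x i))) + (f (x i) - f0 (x i))\<^sup>2)"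
    using assms by (intro sum.cong) (auto simp: power2_eq_square algebra_simps)
  also have "\<dots> = (\<Sum>i=1..n. (e i)\<^sup>2) - 2 * (\<Sum>i=1..n. e i * (f (x i) - f0 (x i)))
      + (\<Sum>i=1..n. (f (x i) - f0 (x i))\<^sup>2)"
    by (simp add: sum.distrib sum_subtractf sum_distrib_left)
  finally show ?thesis
    by (simp add: emp_risk_def emp_norm_sq diff_divide_distrib add_divide_distrib)
qed

text \<open>Expanding both risks, the squared noise cancels, and so do the cross terms with
  \<open>f0\<close>. Noise is left only against \<open>f\<close> and \<open>g\<close>, where the
  sieve bound can be applied.\<close>

lemma emp_norm_basic_inequality:
  assumes y: "\<And>i. i \<in> {1..n} \<Longrightarrow> y i = f0 (x i) + e i"
    and le: "emp_risk x n y f \<le> emp_risk x n y g + R"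
  shows "(emp_norm x n (\<lambda>u. f u - f0 u))\<^sup>2 \<le> (emp_norm x n (\<lambda>u. g u - f0 u))\<^sup>2
    + 2 / real n * ((\<Sum>i=1..n. e i * f (x i)) - (\<Sum>i=1..n. e i * g (x i))) + R"
proof -
  have "emp_risk x n y h = 1 / real n * (\<Sum>i=1..n. (e i)\<^sup>2)
      - 2 / real n * (\<Sum>i=1..n. e i * (h (x i) - f0 (x i))) + (emp_norm x n (\<lambda>u. h u - f0 u))\<^sup>2" for h
    by (rule emp_risk_eq) (rule y)
  with le show ?thesis by (simp add: right_diff_distrib sum_subtractf diff_divide_distrib)
qed

lemma emp_norm_sq_le:
  assumes "n \<ge> 1" "\<And>i. i \<in> {1..n} \<Longrightarrow> \<bar>f (x i)\<bar> \<le> b"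
  shows "(emp_norm x n f)\<^sup>2 \<le> b\<^sup>2"
proof -
  have "(\<Sum>i=1..n. (f (x i))\<^sup>2) \<le> (\<Sum>i=1..n. b\<^sup>2)"
    using assms(2) by (intro sum_mono) (metis abs_ge_zero power2_abs power_mono)
  then show ?thesis using assms(1) by (simp add: emp_norm_sq field_simps)
qed

subsection \<open>Consistency\<close>

theorem theorem3p1:
  fixes M :: "'w measure"
    and X :: "(real ^ 'd) set"
    and x :: "nat \<Rightarrow> real ^ 'd"
    and f0 :: "real ^ 'd \<Rightarrow> real"
    and eps y :: "nat \<Rightarrow> 'w \<Rightarrow> real"
    and \<sigma> :: real
    and r :: "nat \<Rightarrow> nat"
    and V W \<eta> :: "nat \<Rightarrow> real"
    and fhat :: "nat \<Rightarrow> 'w \<Rightarrow> real ^ 'd \<Rightarrow> real"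
  assumes "prob_space M" and "complete_measure M"
    and "compact X" and "\<And>i. i \<ge> 1 \<Longrightarrow> x i \<in> X"
    and "continuous_on X f0"
    and "prob_space.indep_vars M (\<lambda>_. borel) eps {1..}"
    and "\<And>i j. i \<ge> 1 \<Longrightarrow> j \<ge> 1 \<Longrightarrow> distr M borel (eps i) = distr M borel (eps j)"
    and "\<And>i. i \<ge> 1 \<Longrightarrow> integrable M (eps i)"
    and "\<And>i. i \<ge> 1 \<Longrightarrow> integrable M (\<lambda>\<omega>. (eps i \<omega>)\<^sup>2)"
    and "\<And>i. i \<ge> 1 \<Longrightarrow> prob_space.expectation M (eps i) = 0"
    and "\<And>i. i \<ge> 1 \<Longrightarrow> prob_space.variance M (eps i) = \<sigma>\<^sup>2"
    and "\<And>i \<omega>. i \<ge> 1 \<Longrightarrow> \<omega> \<in> space M \<Longrightarrow> y i \<omega> = f0 (x i) + eps i \<omega>"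
    and "\<And>n. n \<ge> 1 \<Longrightarrow> r n \<ge> 1" and "\<And>n. n \<ge> 1 \<Longrightarrow> V n > 4" and "\<And>n. n \<ge> 1 \<Longrightarrow> W n > 0"
    and "mono_on {1..} r" and "mono_on {1..} V" and "mono_on {1..} W"
    and "filterlim r at_top sequentially"
    and "filterlim V at_top sequentially"
    and "filterlim W at_top sequentially"
    and "\<eta> \<longlonglongrightarrow> 0"
    and "approx_sieve_estimator M X x y (\<lambda>n. nn_sieve (r n) (V n) (W n)) \<eta> fhat"
    and "(\<lambda>n. real (r n * (CARD('d) + 2) + 1) * (V n)\<^sup>2 *
              ln (V n * real (r n * (CARD('d) + 2) + 1))) \<in> o(\<lambda>n. real n)"
  shows "tendsto_in_prob M (\<lambda>n \<omega>. emp_norm x n (\<lambda>u. fhat n \<omega> u - f0 u)) 0"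
proof -
  interpret prob_space M by fact
  note x = assms(4) and indep = assms(6) and y = assms(12)
  let ?S = "\<lambda>n. nn_sieve (r n) (V n) (W n) :: (real ^ 'd \<Rightarrow> real) set"
  let ?H = "\<lambda>n. halfspace_traces x n"
  let ?N = "\<lambda>n \<omega>. emp_norm x n (\<lambda>u. fhat n \<omega> u - f0 u)"
  have eps [measurable]: "eps i \<in> borel_measurable M" if "i \<ge> 1" for i
    using indep that by (auto simp: indep_vars_def)
  obtain R where R: "bigO_in_prob M R \<eta>"
    and risk: "\<And>n. n \<ge> 1 \<Longrightarrow> AE \<omega> in M. emp_risk x n (\<lambda>i. y i \<omega>) (fhat n \<omega>)
        \<le> (INF f\<in>?S n. emp_risk x n (\<lambda>i. y i \<omega>) f) + R n \<omega>"
    and fhat: "\<And>n \<omega>. n \<ge> 1 \<Longrightarrow> \<omega> \<in> space M \<Longrightarrow> fhat n \<omega> \<in> ?S n"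
    and fhat_meas: "\<And>n u. n \<ge> 1 \<Longrightarrow> u \<in> X \<Longrightarrow> (\<lambda>\<omega>. fhat n \<omega> u) \<in> borel_measurable M"
    using assms(23) unfolding approx_sieve_estimator_def by blast
  have [measurable]: "R n \<in> borel_measurable M" for n
    using R by (simp add: bigO_in_prob_def)
  have N_meas: "?N n \<in> borel_measurable M" for n
  \<comment> \<open>The estimator is known to be measurable only for \<open>n \<ge> 1\<close>; for
    \<open>n = 0\<close> the empirical norm is the constant 0.\<close>
  proof (cases "n = 0")
    case False
    have [measurable]: "(\<lambda>\<omega>. fhat n \<omega> (x i)) \<in> borel_measurable M" if "i \<in> {1..n}" for i
      using that False x by (intro fhat_meas) auto
    show ?thesis unfolding emp_norm_def by measurable
  qed (simp add: emp_norm_def)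
  have growth: "\<forall>\<^sub>F n in sequentially. (V n)\<^sup>2 * ln (real n) \<le> c * real n" if "0 < c" for c
  proof (rule square_mult_ln_eventually_le[OF _ _ assms(24) that])
    show "V n \<ge> 1" if "n \<ge> 1" for n using assms(14)[OF that] by simp
  qed simp
  have "(\<lambda>n. prob {\<omega>\<in>space M. \<bar>?N n \<omega> - 0\<bar> > e}) \<longlonglongrightarrow> 0" if e: "0 < e" for e
  proof -
    \<comment> \<open>The two noise sums contribute at most \<open>4 * t = e\<^sup>2 / 4\<close>.
      The approximation error and the remainder \<open>R n\<close> each get the same share, and
      three quarters of \<open>e\<^sup>2\<close> stay below \<open>e\<^sup>2\<close>.\<close>
    define t where "t = e\<^sup>2 / 16"
    have t: "t > 0" using e by (simp add: t_def)
    obtain r0 V0 W0 where approx: "\<And>r V W. r \<ge> r0 \<Longrightarrow> V \<ge> V0 \<Longrightarrow> W \<ge> W0 \<Longrightarrow>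
       \<exists>g\<in>nn_sieve r V W. \<forall>u\<in>X. \<bar>g u - f0 u\<bar> < e / 2"
      using nn_sieve_universal_approximation[OF assms(3,5), of "e / 2"] e half_gt_zero by blast
    \<comment> \<open>Two bad events: a large noise sum over some trace, and a large optimisation
      remainder. Outside them the argument is deterministic.\<close>
    define A where "A n = {\<omega>\<in>space M. \<exists>B\<in>?H n. V n * \<bar>\<Sum>i\<in>B. eps i \<omega>\<bar> > real n * t}" for n
    define Q where "Q n = {\<omega>\<in>space M. \<bar>R n \<omega>\<bar> > e\<^sup>2 / 4}" for n
    have A_lim: "(\<lambda>n. prob (A n)) \<longlonglongrightarrow> 0"
      unfolding A_def
    proof (rule max_partial_sum_tendsto_0[OF indep])
      show "V n > 0" if "n \<ge> 1" for n using assms(14)[OF that] by simp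
      show "card (?H n) \<le> (n + 1) ^ (DIM(real ^ 'd) + 1)" for n by (rule card_halfspace_traces)
      show "distr M borel (eps i) = distr M borel (eps j)" if "i \<ge> 1" "j \<ge> 1" for i j
        by (rule assms(7)[OF that])
    qed (use assms(9,10,20) t growth halfspace_traces_subset in blast)+
    have Q_lim: "(\<lambda>n. prob (Q n)) \<longlonglongrightarrow> 0"
      unfolding Q_def using e by (intro bigO_in_prob_tendsto_0[OF R assms(22)] finite_measure_axioms) auto
    have [measurable]: "Q n \<in> events" for n unfolding Q_def by measurable
    have [measurable]: "A n \<in> events" for n
    proof -
      have fin: "finite (?H n)" by (rule finite_subset[OF halfspace_traces_subset]) simp
      have [measurable]: "(\<lambda>\<omega>. \<Sum>i\<in>B. eps i \<omega>) \<in> borel_measurable M" if "B \<in> ?H n" for B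
        
      proof (intro borel_measurable_sum eps)
        have "B \<subseteq> {1..n}" using that halfspace_traces_subset[of x n] by blast
        then show "i \<ge> 1" if "i \<in> B" for i using that by auto
      qed
      have "A n = (\<Union>B\<in>?H n. {\<omega>\<in>space M. V n * \<bar>\<Sum>i\<in>B. eps i \<omega>\<bar> > real n * t})"
        by (auto simp: A_def)
      also have "\<dots> \<in> events" using fin by (intro sets.finite_UN) auto
      finally show ?thesis .
    qed
    have "\<forall>\<^sub>F n in sequentially. r n \<ge> r0" "\<forall>\<^sub>F n in sequentially. V n \<ge> V0"
        "\<forall>\<^sub>F n in sequentially. W n \<ge> W0" "\<forall>\<^sub>F n in sequentially. n \<ge> (1::nat)"
      using assms(19-21) by (auto simp: filterlim_at_top eventually_ge_at_top)
    then have bound: "\<forall>\<^sub>F n in sequentially. prob {\<omega>\<in>space M. \<bar>?N n \<omega> - 0\<bar> > e} \<le> prob (A n) + prob (Q n)"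
    proof eventually_elim
      case (elim n)
      have n: "n \<ge> 1" "real n > 0" using elim by auto
      obtain g where g: "g \<in> ?S n" "\<forall>u\<in>X. \<bar>g u - f0 u\<bar> < e / 2"
        using approx elim by blast
      have gn: "(emp_norm x n (\<lambda>u. g u - f0 u))\<^sup>2 \<le> (e / 2)\<^sup>2"
        using g(2) x by (intro emp_norm_sq_le n) (auto intro: less_imp_le)
      \<comment> \<open>The near-minimisation property holds only almost surely, so the inclusion of
        events does too.\<close>
      have "AE \<omega> in M. \<omega> \<in> {\<omega>\<in>space M. \<bar>?N n \<omega> - 0\<bar> > e} \<longrightarrow> \<omega> \<in> A n \<union> Q n"
        using risk[OF n(1)] AE_space
      proof eventually_elim
        case (elim \<omega>)
        show ?case
        proof (rule impI, rule ccontr)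
          assume gt: "\<omega> \<in> {\<omega>\<in>space M. \<bar>?N n \<omega> - 0\<bar> > e}" and no: "\<omega> \<notin> A n \<union> Q n"
          \<comment> \<open>The infimum is a lower bound because the risks are bounded below by
            0.\<close>
          have "(INF f\<in>?S n. emp_risk x n (\<lambda>i. y i \<omega>) f) \<le> emp_risk x n (\<lambda>i. y i \<omega>) g"
            using g(1) by (intro cINF_lower bdd_belowI2[where m = 0])
              (auto simp: emp_risk_def intro!: divide_nonneg_nonneg sum_nonneg)
          with elim have "emp_risk x n (\<lambda>i. y i \<omega>) (fhat n \<omega>) \<le> emp_risk x n (\<lambda>i. y i \<omega>) g + R n \<omega>"
            by simp
          then have basic: "(?N n \<omega>)\<^sup>2 \<le> (emp_norm x n (\<lambda>u. g u - f0 u))\<^sup>2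
              + 2 / real n * ((\<Sum>i=1..n. eps i \<omega> * fhat n \<omega> (x i)) - (\<Sum>i=1..n. eps i \<omega> * g (x i)))
              + R n \<omega>"
            using y elim by (intro emp_norm_basic_inequality) auto
          have Vn: "V n > 0" using assms(14)[OF n(1)] by simp
          \<comment> \<open>Dividing by \<open>V n\<close> here lets the total weight
            \<open>V n\<close> of a network restore the bound \<open>real n * t\<close>.\<close>
          have "\<bar>\<Sum>i\<in>B. eps i \<omega>\<bar> \<le> real n * t / V n" if "B \<in> ?H n" for B
          proof -
            have "V n * \<bar>\<Sum>i\<in>B. eps i \<omega>\<bar> \<le> real n * t"
              using no elim that by (auto simp: A_def not_less)
            then show ?thesis using Vn by (simp add: field_simps)
          qed
          then have "\<bar>\<Sum>i=1..n. eps i \<omega> * h (x i)\<bar> \<le> V n * (real n * t / V n)" if "h \<in> ?S n" for h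
            by (intro abs_sum_nn_sieve_le[OF that])
          then have noise: "\<bar>\<Sum>i=1..n. eps i \<omega> * h (x i)\<bar> \<le> real n * t" if "h \<in> ?S n" for h
            using that Vn by simp
          have "2 / real n * ((\<Sum>i=1..n. eps i \<omega> * fhat n \<omega> (x i)) - (\<Sum>i=1..n. eps i \<omega> * g (x i)))
              \<le> 2 / real n * (2 * (real n * t))"
          proof (rule mult_left_mono)
            show "(\<Sum>i=1..n. eps i \<omega> * fhat n \<omega> (x i)) - (\<Sum>i=1..n. eps i \<omega> * g (x i))
                \<le> 2 * (real n * t)"
              using noise[OF fhat[OF n(1) elim(2)]] noise[OF g(1)] by linarith
          qed simp
          also have "\<dots> = e\<^sup>2 / 4" using n by (simp add: t_def)
          finally have "2 / real n * ((\<Sum>i=1..n. eps i \<omega> * fhat n \<omega> (x i))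
              - (\<Sum>i=1..n. eps i \<omega> * g (x i))) \<le> e\<^sup>2 / 4" .
          moreover have "R n \<omega> \<le> e\<^sup>2 / 4" using no elim by (auto simp: Q_def)
          moreover have "(e / 2)\<^sup>2 = e\<^sup>2 / 4" by (simp add: power_divide)
          ultimately have "(?N n \<omega>)\<^sup>2 \<le> e\<^sup>2 / 4 + e\<^sup>2 / 4 + e\<^sup>2 / 4"
            using basic gn by linarith
          also have "\<dots> < e\<^sup>2" using e by simp
          finally have "?N n \<omega> < e" by (rule power2_less_imp_less) (use e in simp)
          moreover have "?N n \<omega> \<ge> 0" by (simp add: emp_norm_def sum_nonneg)
          ultimately show False using gt by simp
        qed
      qed
      then have "prob {\<omega>\<in>space M. \<bar>?N n \<omega> - 0\<bar> > e} \<le> prob (A n \<union> Q n)"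
        by (intro finite_measure_mono_AE) measurable
      also have "\<dots> \<le> prob (A n) + prob (Q n)" by (intro measure_Un_le) measurable
      finally show ?case .
    qed
    have lim: "(\<lambda>n. prob (A n) + prob (Q n)) \<longlonglongrightarrow> 0"
      using tendsto_add[OF A_lim Q_lim] by simp
    show ?thesis
      by (rule real_tendsto_sandwich[OF _ bound tendsto_const lim]) simp
  qed
  with N_meas show ?thesis by (simp add: tendsto_in_prob_def)
qed

end
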